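(* Let $\mu$ be a positive Borel measure on $[0,1)$ with $\int_{[0,1)}\log\frac{2}{1-t}\,d\mu(t)<\infty$. If the measure $\nu$ on $[0,1)$ defined by $d\nu(t)=\log\frac{2}{1-t}\,d\mu(t)$ is a vanishing Carleson measure, then: (i) The operator $I_\mu$ is a compact operator from $\mathcal B$ into $BMOA$. (ii) The operator $I_\mu$ is a compact operator from $BMOA$ into itself.
   Context: $\mathbb D=\{z\in\mathbb C:|z|<1\}$. The Bloch space $\mathcal B$ is the set of analytic functions $f$ in $\mathbb D$ with $\|f\|_{\mathcal B}=|f(0)|+\sup_{z\in\mathbb D}(1-|z|^2)|f'(z)|<\infty$. For $a\in\mathbb D$ let $\varphi_a(z)=\frac{a-z}{1-\overline a z}$; $BMOA$ is the set of analytic functions $f$ in $\mathbb D$ with $\|f\|_{BMOA}=|f(0)|+\sup_{a\in\mathbb D}\|f\circ\varphi_a-f(a)\|_{H^2}<\infty$, where $H^2$ is the Hardy space. The operator $I_\mu$ is given by $I_\mu(f)(z)=\int_{[0,1)}\frac{f(t)}{1-tz}\,d\mu(t)$, $z\in\mathbb D$ (under the integrability hypothesis on $\mu$ it is well defined, with analytic values, for all $f\in\mathcal B$, and $BMOA\subset\mathcal B$). A positive Borel measure $\nu$ on $[0,1)$ is a vanishing Carleson measure if it is a Carleson measure (there is $C>0$ with $\nu([t,1))\le C(1-t)$ for all $0\le t<1$) and $\lim_{t\to1^-}\frac{\nu([t,1))}{1-t}=0$. *)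

theory Defs
  imports "HOL-Complex_Analysis.Complex_Analysis"
begin

text \<open>A function on the unit disc is represented by the function on \<open>complex\<close> extending it by
  \<open>0\<close>. Thus functions that agree on the disc are equal, and the norms below are norms, not merely
  seminorms, on the spaces that they define. A norm value \<open>\<infinity>\<close> of a
  holomorphic function means that it is not in the space.\<close>

definition disc_holomorphic :: "(complex \<Rightarrow> complex) set" where
  "disc_holomorphic = {f. f holomorphic_on ball 0 1 \<and> (\<forall>z. z \<notin> ball 0 1 \<longrightarrow> f z = 0)}"

definition bloch_norm :: "(complex \<Rightarrow> complex) \<Rightarrow> ennreal" where
  "bloch_norm f =
     ennreal (norm (f 0)) + (SUP z\<in>ball 0 1. ennreal ((1 - (norm z)\<^sup>2) * norm (deriv f z)))"

definition bloch :: "(complex \<Rightarrow> complex) set" where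
  "bloch = {f \<in> disc_holomorphic. bloch_norm f < \<infinity>}"

definition circle_mean2 :: "real \<Rightarrow> (complex \<Rightarrow> complex) \<Rightarrow> real" where
  "circle_mean2 r g =
     sqrt (1 / (2 * pi) * integral {0..2 * pi} (\<lambda>\<theta>. (norm (g (of_real r * cis \<theta>)))\<^sup>2))"

definition hardy2_norm :: "(complex \<Rightarrow> complex) \<Rightarrow> ennreal" where
  "hardy2_norm g = (SUP r\<in>{0<..<1}. ennreal (circle_mean2 r g))"

definition disc_aut :: "complex \<Rightarrow> complex \<Rightarrow> complex" where
  "disc_aut a z = (a - z) / (1 - cnj a * z)"

definition bmoa_norm :: "(complex \<Rightarrow> complex) \<Rightarrow> ennreal" where
  "bmoa_norm f =
     ennreal (norm (f 0)) + (SUP a\<in>ball 0 1. hardy2_norm (\<lambda>z. f (disc_aut a z) - f a))"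

definition bmoa :: "(complex \<Rightarrow> complex) set" where
  "bmoa = {f \<in> disc_holomorphic. bmoa_norm f < \<infinity>}"

definition I_op :: "real measure \<Rightarrow> (complex \<Rightarrow> complex) \<Rightarrow> complex \<Rightarrow> complex" where
  "I_op \<mu> f z =
     (if z \<in> ball 0 1 then \<integral>t. f (of_real t) / (1 - of_real t * z) \<partial>\<mu> else 0)"

definition borel_measure_on_01 :: "real measure \<Rightarrow> bool" where
  "borel_measure_on_01 \<mu> \<longleftrightarrow> sets \<mu> = sets (restrict_space borel {0..<1})"

definition carleson_measure :: "real measure \<Rightarrow> bool" where
  "carleson_measure \<nu> \<longleftrightarrow>
     borel_measure_on_01 \<nu> \<and> (\<exists>C>0. \<forall>t\<in>{0..<1}. emeasure \<nu> {t..<1} \<le> ennreal (C * (1 - t)))"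

definition vanishing_carleson_measure :: "real measure \<Rightarrow> bool" where
  "vanishing_carleson_measure \<nu> \<longleftrightarrow>
     carleson_measure \<nu> \<and> ((\<lambda>t. emeasure \<nu> {t..<1} / ennreal (1 - t)) \<longlongrightarrow> 0) (at_left 1)"

definition norm_dist ::
  "((complex \<Rightarrow> complex) \<Rightarrow> ennreal) \<Rightarrow> (complex \<Rightarrow> complex) \<Rightarrow> (complex \<Rightarrow> complex) \<Rightarrow> real" where
  "norm_dist N f g = enn2real (N (\<lambda>z. f z - g z))"

definition norm_topology ::
  "(complex \<Rightarrow> complex) set \<Rightarrow> ((complex \<Rightarrow> complex) \<Rightarrow> ennreal) \<Rightarrow> (complex \<Rightarrow> complex) topology" where
  "norm_topology X N = Metric_space.mtopology X (norm_dist N)"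

text \<open>\<open>T\<close> is a linear operator from \<open>(X, N)\<close> into \<open>(Y, N')\<close> that maps bounded sets to
  relatively compact sets; only the values of \<open>T\<close> on \<open>X\<close> matter.\<close>

definition compact_operator ::
  "(complex \<Rightarrow> complex) set \<Rightarrow> ((complex \<Rightarrow> complex) \<Rightarrow> ennreal) \<Rightarrow>
   (complex \<Rightarrow> complex) set \<Rightarrow> ((complex \<Rightarrow> complex) \<Rightarrow> ennreal) \<Rightarrow>
   ((complex \<Rightarrow> complex) \<Rightarrow> complex \<Rightarrow> complex) \<Rightarrow> bool" where
  "compact_operator X N Y N' T \<longleftrightarrow>
     T \<in> X \<rightarrow> Y \<and>
     (\<forall>f\<in>X. \<forall>g\<in>X. T (\<lambda>z. f z + g z) = (\<lambda>z. T f z + T g z)) \<and>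
     (\<forall>c. \<forall>f\<in>X. T (\<lambda>z. c * f z) = (\<lambda>z. c * T f z)) \<and>
     (\<forall>S. S \<subseteq> X \<and> (\<exists>B::real. \<forall>f\<in>S. N f \<le> ennreal B) \<longrightarrow>
        compactin (norm_topology Y N') (norm_topology Y N' closure_of (T ` S)))"

text \<open>The constant \<open>Metric_space.mtopology\<close> is meaningful only for a metric, so here is a proof
  that the norm of \<open>BMOA\<close> induces one.\<close>

lemma disc_aut_in_disc:
  assumes "norm a < 1" "norm z < 1"
  shows "norm (disc_aut a z) < 1" "1 - cnj a * z \<noteq> 0"
proof -
  have "norm (cnj a * z) < 1"
    using assms by (simp add: norm_mult) (metis mult_strict_mono' mult_1 norm_ge_zero)
  then show nz: "1 - cnj a * z \<noteq> 0" by auto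
  have "(norm (1 - cnj a * z))\<^sup>2 - (norm (a - z))\<^sup>2 = (1 - (norm a)\<^sup>2) * (1 - (norm z)\<^sup>2)"
    unfolding cmod_power2 by (simp add: power2_eq_square algebra_simps)
  moreover have "\<dots> > 0"
    using assms by (simp add: abs_square_less_1)
  ultimately have "norm (a - z) < norm (1 - cnj a * z)"
    by (metis diff_gt_0_iff_gt norm_ge_zero power2_less_imp_less)
  with nz show "norm (disc_aut a z) < 1"
    by (simp add: disc_aut_def norm_divide divide_simps)
qed

lemma holomorphic_disc_aut:
  assumes "f holomorphic_on ball 0 1" "a \<in> ball 0 1"
  shows "(\<lambda>z. f (disc_aut a z) - f a) holomorphic_on ball 0 1"
proof -
  have "disc_aut a holomorphic_on ball 0 1"
    using assms disc_aut_in_disc(2) unfolding disc_aut_def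
    by (intro holomorphic_intros) auto
  then have "(f \<circ> disc_aut a) holomorphic_on ball 0 1"
    using assms disc_aut_in_disc(1) by (intro holomorphic_on_compose_gen[OF _ assms(1)]) auto
  then show ?thesis
    by (auto simp: o_def intro!: holomorphic_intros)
qed

lemma continuous_on_circle:
  assumes "g holomorphic_on ball 0 1" "0 < r" "r < 1"
  shows "continuous_on {0..2 * pi} (\<lambda>\<theta>. g (of_real r * cis \<theta>))"
proof -
  have "continuous_on {0..2 * pi} (\<lambda>\<theta>. of_real r * cis \<theta>)"
    by (intro continuous_intros)
  then show ?thesis
    using assms
    by (intro continuous_on_compose2[OF holomorphic_on_imp_continuous_on[OF assms(1)]])
       (auto simp: norm_mult)
qed

lemma circle_mean2_nonneg: "circle_mean2 r g \<ge> 0"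
proof -
  have "integral {0..2 * pi} (\<lambda>\<theta>. (norm (g (of_real r * cis \<theta>)))\<^sup>2) \<ge> 0"
    by (cases "(\<lambda>\<theta>. (norm (g (of_real r * cis \<theta>)))\<^sup>2) integrable_on {0..2 * pi}")
       (auto intro: integral_nonneg simp: not_integrable_integral)
  then show ?thesis
    by (simp add: circle_mean2_def)
qed

lemma sqrt_integral_triangle:
  fixes F G :: "real \<Rightarrow> complex"
  assumes F: "continuous_on {a..b} F" and G: "continuous_on {a..b} G"
  shows "sqrt (integral {a..b} (\<lambda>t. (norm (F t + G t))\<^sup>2))
    \<le> sqrt (integral {a..b} (\<lambda>t. (norm (F t))\<^sup>2)) + sqrt (integral {a..b} (\<lambda>t. (norm (G t))\<^sup>2))"
proof (rule field_le_epsilon)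
  fix e :: real assume e: "e > 0"
  let ?I = "\<lambda>F::real \<Rightarrow> complex. integral {a..b} (\<lambda>t. (norm (F t))\<^sup>2)"
  have int: "(\<lambda>t. (norm (F t))\<^sup>2) integrable_on {a..b}" "(\<lambda>t. (norm (G t))\<^sup>2) integrable_on {a..b}"
    "(\<lambda>t. (norm (F t + G t))\<^sup>2) integrable_on {a..b}"
    by (intro integrable_continuous_interval continuous_intros F G)+
  have nn: "?I F \<ge> 0" "?I G \<ge> 0"
    by (auto intro!: integral_nonneg int)
  define A B where "A = sqrt (?I F) + e / 2" and "B = sqrt (?I G) + e / 2"
  have AB: "A > 0" "B > 0"
    using nn e by (auto simp: A_def B_def intro!: add_nonneg_pos)
  have A2: "?I F \<le> A\<^sup>2" "?I G \<le> B\<^sup>2"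
    using nn e by (auto simp: A_def B_def intro!: sqrt_le_D)
  have pt: "(norm (F t + G t))\<^sup>2 \<le> (1 + B / A) * (norm (F t))\<^sup>2 + (1 + A / B) * (norm (G t))\<^sup>2" for t
  proof -
    define x y where "x = norm (F t)" and "y = norm (G t)"
    have "(norm (F t + G t))\<^sup>2 \<le> (x + y)\<^sup>2"
      unfolding x_def y_def by (intro power_mono norm_triangle_ineq) auto
    moreover have "(1 + B / A) * x\<^sup>2 + (1 + A / B) * y\<^sup>2 - (x + y)\<^sup>2 = (B * x - A * y)\<^sup>2 / (A * B)"
      using AB by (simp add: field_simps power2_eq_square)
    moreover have "(B * x - A * y)\<^sup>2 / (A * B) \<ge> 0"
      using AB by simp
    ultimately show ?thesis
      unfolding x_def y_def by linarith
  qed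
  have "?I (\<lambda>t. F t + G t)
      \<le> integral {a..b} (\<lambda>t. (1 + B / A) * (norm (F t))\<^sup>2 + (1 + A / B) * (norm (G t))\<^sup>2)"
    by (intro integral_le integrable_add integrable_on_mult_right int pt)
  also have "\<dots> = (1 + B / A) * ?I F + (1 + A / B) * ?I G"
    using int by (simp add: integral_add integrable_on_mult_right)
  also have "\<dots> \<le> (1 + B / A) * A\<^sup>2 + (1 + A / B) * B\<^sup>2"
    using AB A2 by (intro add_mono mult_left_mono) auto
  also have "\<dots> = (A + B)\<^sup>2"
    using AB by (simp add: field_simps power2_eq_square)
  finally have "sqrt (?I (\<lambda>t. F t + G t)) \<le> A + B"
    using AB by (intro real_le_lsqrt) auto
  then show "sqrt (?I (\<lambda>t. F t + G t)) \<le> sqrt (?I F) + sqrt (?I G) + e"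
    by (simp add: A_def B_def)
qed

lemma hardy2_norm_triangle:
  assumes "f holomorphic_on ball 0 1" "g holomorphic_on ball 0 1"
  shows "hardy2_norm (\<lambda>z. f z + g z) \<le> hardy2_norm f + hardy2_norm g"
  unfolding hardy2_norm_def
proof (rule SUP_least)
  fix r :: real assume r: "r \<in> {0<..<1}"
  have "circle_mean2 r (\<lambda>z. f z + g z) \<le> circle_mean2 r f + circle_mean2 r g"
    using mult_left_mono[OF sqrt_integral_triangle[OF continuous_on_circle[OF assms(1)]
          continuous_on_circle[OF assms(2)]], of r r "sqrt (1 / (2 * pi))"] r
    unfolding circle_mean2_def real_sqrt_mult distrib_left by simp
  then have "ennreal (circle_mean2 r (\<lambda>z. f z + g z))
      \<le> ennreal (circle_mean2 r f) + ennreal (circle_mean2 r g)"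
    by (simp add: circle_mean2_nonneg ennreal_leI flip: ennreal_plus)
  also have "\<dots> \<le> (SUP r\<in>{0<..<1}. ennreal (circle_mean2 r f)) + (SUP r\<in>{0<..<1}. ennreal (circle_mean2 r g))"
    using r by (intro add_mono SUP_upper) auto
  finally show "ennreal (circle_mean2 r (\<lambda>z. f z + g z))
      \<le> (SUP r\<in>{0<..<1}. ennreal (circle_mean2 r f)) + (SUP r\<in>{0<..<1}. ennreal (circle_mean2 r g))" .
qed

lemma bmoa_norm_triangle:
  assumes f: "f holomorphic_on ball 0 1" and g: "g holomorphic_on ball 0 1"
  shows "bmoa_norm (\<lambda>z. f z + g z) \<le> bmoa_norm f + bmoa_norm g"
proof -
  let ?h = "\<lambda>f a. hardy2_norm (\<lambda>z. f (disc_aut a z) - f a)"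
  have "(SUP a\<in>ball 0 1. ?h (\<lambda>z. f z + g z) a) \<le> (SUP a\<in>ball 0 1. ?h f a) + (SUP a\<in>ball 0 1. ?h g a)"
  proof (rule SUP_least)
    fix a :: complex assume a: "a \<in> ball 0 1"
    have "?h (\<lambda>z. f z + g z) a \<le> ?h f a + ?h g a"
      using hardy2_norm_triangle[OF holomorphic_disc_aut[OF f a] holomorphic_disc_aut[OF g a]]
      by (simp add: algebra_simps)
    also have "\<dots> \<le> (SUP a\<in>ball 0 1. ?h f a) + (SUP a\<in>ball 0 1. ?h g a)"
      using a by (intro add_mono SUP_upper) auto
    finally show "?h (\<lambda>z. f z + g z) a \<le> (SUP a\<in>ball 0 1. ?h f a) + (SUP a\<in>ball 0 1. ?h g a)" .
  qed
  moreover have "ennreal (norm (f 0 + g 0)) \<le> ennreal (norm (f 0)) + ennreal (norm (g 0))"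
    by (simp add: norm_triangle_ineq ennreal_leI flip: ennreal_plus)
  ultimately have "bmoa_norm (\<lambda>z. f z + g z) \<le> (ennreal (norm (f 0)) + ennreal (norm (g 0))) +
      ((SUP a\<in>ball 0 1. ?h f a) + (SUP a\<in>ball 0 1. ?h g a))"
    unfolding bmoa_norm_def by (rule add_mono[rotated])
  also have "\<dots> = bmoa_norm f + bmoa_norm g"
    unfolding bmoa_norm_def by (simp add: ac_simps)
  finally show ?thesis .
qed

lemma bmoa_norm_minus_commute: "bmoa_norm (\<lambda>z. f z - g z) = bmoa_norm (\<lambda>z. g z - f z)"
proof -
  have *: "norm ((f x - g x) - (f y - g y)) = norm ((g x - f x) - (g y - f y))" for x y
    by (subst norm_minus_cancel[symmetric]) (simp add: algebra_simps)
  show ?thesis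
    unfolding bmoa_norm_def hardy2_norm_def circle_mean2_def
    by (simp only: * norm_minus_commute[of "f 0" "g 0"])
qed

lemma bmoa_norm_eq_0_imp:
  assumes f: "f holomorphic_on ball 0 1" and 0: "bmoa_norm f = 0" and z: "z \<in> ball 0 1"
  shows "f z = 0"
proof -
  have f0: "f 0 = 0"
    using 0 by (simp add: bmoa_norm_def)
  have mean: "circle_mean2 r (\<lambda>z. f (- z)) = 0" if r: "r \<in> {0<..<1}" for r
  proof -
    have "ennreal (circle_mean2 r (\<lambda>z. f (- z))) \<le> hardy2_norm (\<lambda>z. f (- z))"
      unfolding hardy2_norm_def using r by (intro SUP_upper)
    also have "\<dots> = hardy2_norm (\<lambda>z. f (disc_aut 0 z) - f 0)"
      by (simp add: disc_aut_def f0)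
    also have "\<dots> \<le> (SUP a\<in>ball 0 1. hardy2_norm (\<lambda>z. f (disc_aut a z) - f a))"
      by (intro SUP_upper) auto
    also have "\<dots> = 0"
      using 0 unfolding bmoa_norm_def by (metis add_eq_0_iff_both_eq_0)
    finally show ?thesis
      using circle_mean2_nonneg[of r "\<lambda>z. f (- z)"] by (simp add: ennreal_eq_0_iff)
  qed
  show ?thesis
  proof (cases "z = 0")
    case False
    define r where "r = norm z"
    have r: "r \<in> {0<..<1}"
      using z False by (auto simp: r_def)
    have "(\<lambda>z. f (- z)) holomorphic_on ball 0 1"
      using holomorphic_disc_aut[OF f, of 0] by (simp add: disc_aut_def f0)
    then have cont: "continuous_on {0..2 * pi} (\<lambda>\<theta>. (norm (f (- (of_real r * cis \<theta>))))\<^sup>2)"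
      using continuous_on_circle[of "\<lambda>z. f (- z)" r] r by (intro continuous_intros) auto
    have "integral {0..2 * pi} (\<lambda>\<theta>. (norm (f (- (of_real r * cis \<theta>))))\<^sup>2) = 0"
      using mean[OF r] by (simp add: circle_mean2_def)
    then have all0: "\<And>\<theta>. \<theta> \<in> {0..2 * pi} \<Longrightarrow> (norm (f (- (of_real r * cis \<theta>))))\<^sup>2 = 0"
      using integral_eq_0_iff[OF cont] by auto
    have "- z = of_real r * cis (Arg2pi (- z))"
      using Arg2pi_eq[of "- z"] by (simp add: r_def cis_conv_exp)
    moreover have "Arg2pi (- z) \<in> {0..2 * pi}"
      using Arg2pi[of "- z"] by auto
    ultimately have "(norm (f (- (- z))))\<^sup>2 = 0"
      using all0 by metis
    then show ?thesis by simp
  qed (simp add: f0)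
qed

lemma bmoa_diff:
  assumes "f \<in> bmoa" "g \<in> bmoa"
  shows "(\<lambda>z. f z - g z) \<in> bmoa"
proof -
  have hol: "f holomorphic_on ball 0 1" "g holomorphic_on ball 0 1" "(\<lambda>z. - g z) holomorphic_on ball 0 1"
    using assms by (auto simp: bmoa_def disc_holomorphic_def intro!: holomorphic_intros)
  have "bmoa_norm (\<lambda>z. f z - g z) \<le> bmoa_norm f + bmoa_norm (\<lambda>z. 0 - g z)"
    using bmoa_norm_triangle[OF hol(1,3)] by simp
  also have "bmoa_norm (\<lambda>z. 0 - g z) = bmoa_norm g"
    using bmoa_norm_minus_commute[of "\<lambda>_. 0" g] by simp
  also have "bmoa_norm f + bmoa_norm g < \<infinity>"
    using assms by (simp add: bmoa_def)
  finally show ?thesis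
    using assms by (auto simp: bmoa_def disc_holomorphic_def intro!: holomorphic_intros)
qed

lemma Metric_space_bmoa: "Metric_space bmoa (norm_dist bmoa_norm)"
proof
  fix f g h
  show "0 \<le> norm_dist bmoa_norm f g"
    by (simp add: norm_dist_def)
  show "norm_dist bmoa_norm f g = norm_dist bmoa_norm g f"
    by (simp add: norm_dist_def bmoa_norm_minus_commute[of f g])
  assume f: "f \<in> bmoa" and g: "g \<in> bmoa"
  have d: "(\<lambda>z. f z - g z) \<in> bmoa"
    by (rule bmoa_diff[OF f g])
  show "norm_dist bmoa_norm f g = 0 \<longleftrightarrow> f = g"
  proof
    assume "norm_dist bmoa_norm f g = 0"
    then have 0: "bmoa_norm (\<lambda>z. f z - g z) = 0"
      using d by (auto simp: norm_dist_def bmoa_def enn2real_eq_0_iff)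
    show "f = g"
    proof
      fix z
      show "f z = g z"
        using bmoa_norm_eq_0_imp[OF _ 0, of z] d f g
        by (cases "z \<in> ball 0 1") (auto simp: bmoa_def disc_holomorphic_def)
    qed
  qed (simp add: norm_dist_def bmoa_norm_def hardy2_norm_def circle_mean2_def)
  assume h: "h \<in> bmoa"
  have d': "(\<lambda>z. g z - h z) \<in> bmoa"
    by (rule bmoa_diff[OF g h])
  have "bmoa_norm (\<lambda>z. f z - h z) \<le> bmoa_norm (\<lambda>z. f z - g z) + bmoa_norm (\<lambda>z. g z - h z)"
    using bmoa_norm_triangle[of "\<lambda>z. f z - g z" "\<lambda>z. g z - h z"] d d'
    by (simp add: bmoa_def disc_holomorphic_def)
  then have "norm_dist bmoa_norm f h
      \<le> enn2real (bmoa_norm (\<lambda>z. f z - g z) + bmoa_norm (\<lambda>z. g z - h z))"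
    using d d' unfolding norm_dist_def by (intro enn2real_mono) (auto simp: bmoa_def)
  also have "\<dots> = norm_dist bmoa_norm f g + norm_dist bmoa_norm g h"
    using d d' unfolding norm_dist_def by (intro enn2real_plus) (auto simp: bmoa_def)
  finally show "norm_dist bmoa_norm f h \<le> norm_dist bmoa_norm f g + norm_dist bmoa_norm g h" .
qed

end

theory Submission
  imports Defs
begin

text \<open>
  Write \<open>L(t) = ln (2 / (1 - t))\<close> and \<open>\<phi>\<^sub>a\<close> for the disc automorphism exchanging \<open>0\<close> and \<open>a\<close>.

  The core is one norm estimate (\<open>bmoa_norm_I_op_le\<close>): if the measure \<open>|F| d\<mu>\<close> gives mass at most
  \<open>K (1 - t)\<close> to every \<open>[t, 1)\<close>, then \<open>z \<mapsto> \<integral> F(t) / (1 - t z) d\<mu>(t)\<close> has \<open>BMOA\<close> norm at most a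
  constant times \<open>K\<close>. Composing the Cauchy kernel \<open>1 / (1 - t z)\<close> with \<open>\<phi>\<^sub>a\<close> and subtracting its value
  at \<open>a\<close> gives a multiple of \<open>w / (1 - b w)\<close> with \<open>|b| < 1\<close>. The Poisson integral then computes its
  \<open>H\<^sup>2\<close> norm, which is at most \<open>(1 - |a|\<^sup>2)\<^sup>1\<^sup>/\<^sup>2 / (|1 - t a| (1 - t\<^sup>2)\<^sup>1\<^sup>/\<^sup>2)\<close>. By Minkowski's integral inequality
  the \<open>H\<^sup>2\<close> norm of the transform is at most the integral of this quantity against \<open>|F| d\<mu>\<close>. The
  quantity is bounded by an increasing function of \<open>t\<close>, and the integral of an increasing
  function against a measure with Carleson constant \<open>K\<close> is at most \<open>K\<close> times its Lebesgue integral
  (\<open>carleson_nn_integral_mono_le\<close>). The Lebesgue integral is an arctangent, bounded uniformly in \<open>a\<close>.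

  Bloch functions enter only through their growth \<open>|f(t)| \<le> 2 B L(t)\<close> and through a Montel theorem:
  a sequence in a ball of the Bloch space has a subsequence converging locally uniformly to a
  function \<open>g\<close> of the same ball. The differences \<open>h = f\<^sub>n - g\<close> satisfy \<open>|h| \<le> 4 B L\<close> everywhere and
  tend to \<open>0\<close> uniformly on each \<open>[0, R]\<close>. Near \<open>1\<close> the measure \<open>L d\<mu>\<close> has arbitrarily small Carleson
  constant, because it is vanishing Carleson; on \<open>[0, R]\<close> the mass of \<open>|h| d\<mu>\<close> tends to \<open>0\<close>. So the
  constant \<open>K\<close> for \<open>|h| d\<mu>\<close> tends to \<open>0\<close>, and the images of the subsequence converge in \<open>BMOA\<close>
  (\<open>bmoa_norm_I_op_eventually_le\<close>). Their limit is the image of \<open>g\<close>, so the image of a Bloch ball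
  is itself compact in \<open>BMOA\<close>. Both assertions follow, as bounded sets of \<open>BMOA\<close> are bounded in the
  Bloch space.
\<close>

section \<open>Integrals against Carleson measures on the unit interval\<close>

text \<open>Every superlevel set of an increasing function is an interval ending at \<open>1\<close>, so \<open>\<nu>\<close> charges it with
  at most \<open>K\<close> times its length. Integrating over the levels (layer cake formula, by Tonelli) turns
  this into the comparison of the two integrals.\<close>

lemma carleson_nn_integral_mono_le:
  fixes \<nu> :: "real measure"
  assumes sets: "sets \<nu> = sets (restrict_space borel {0..<1})"
    and K: "K \<ge> 0" "\<And>t. t \<in> {0..<1} \<Longrightarrow> emeasure \<nu> {t..<1} \<le> ennreal (K * (1 - t))"
    and h[measurable]: "h \<in> borel_measurable borel"
    and mono: "mono_on {0..<1} h"
  shows "(\<integral>\<^sup>+t. ennreal (h t) \<partial>\<nu>) \<le> ennreal K * (\<integral>\<^sup>+t\<in>{0..<1}. ennreal (h t) \<partial>lborel)"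
proof -
  have space: "space \<nu> = {0..<1}"
    using sets_eq_imp_space_eq[OF sets] by (simp add: space_restrict_space)
  have id[measurable]: "(\<lambda>t. t) \<in> measurable \<nu> borel"
    unfolding measurable_cong_sets[OF sets refl] by (rule measurable_restrict_space1) simp
  have "emeasure \<nu> (space \<nu>) \<noteq> \<infinity>"
    using K(2)[of 0] by (auto simp: space top_unique)
  then interpret \<nu>: finite_measure \<nu>
    by (rule finite_measureI)
  interpret pair_sigma_finite lborel \<nu> ..
  have bound: "emeasure \<nu> {t \<in> space \<nu>. x < h t} \<le> ennreal K * emeasure lborel {t \<in> {0..<1}. x < h t}" for x
  proof (cases "{t \<in> space \<nu>. x < h t} = {}")
    case False
    define U where "U = {t \<in> space \<nu>. x < h t}"
    have U: "U \<noteq> {}" "bdd_below U" "U \<subseteq> {0..<1}"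
      using False by (auto simp: U_def space intro!: bdd_belowI[of _ 0])
    define m where "m = Inf U"
    obtain u where u: "u \<in> U" using U by auto
    have "m \<ge> 0" unfolding m_def using U by (intro cInf_greatest) auto
    moreover have "m \<le> u" unfolding m_def using U u by (intro cInf_lower) auto
    ultimately have m: "m \<in> {0..<1}" using u U by auto
    have "emeasure \<nu> U \<le> emeasure \<nu> {m..<1}"
      using U m by (intro emeasure_mono) (auto simp: m_def cInf_lower sets sets_restrict_space_iff)
    also have "\<dots> \<le> ennreal (K * (1 - m))" by (rule K(2)[OF m])
    also have "\<dots> = ennreal K * emeasure lborel {m<..<1}"
      using m K(1) by (simp add: ennreal_mult)
    also have "\<dots> \<le> ennreal K * emeasure lborel {t \<in> {0..<1}. x < h t}"
    proof (intro mult_left_mono emeasure_mono subsetI)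
      fix t assume t: "t \<in> {m<..<1}"
      then obtain v where v: "v \<in> U" "v < t"
        using cInf_lessD[OF U(1), of t] by (auto simp: m_def)
      have "h v \<le> h t" using v t U(3) m by (intro mono_onD[OF mono]) auto
      then show "t \<in> {t \<in> {0..<1}. x < h t}" using v t m by (auto simp: U_def)
    qed auto
    finally show ?thesis by (simp add: U_def)
  next
    case True
    show ?thesis unfolding True by simp
  qed
  have layer: "ennreal c = (\<integral>\<^sup>+x. indicator {x. 0 \<le> x \<and> x < c} x \<partial>lborel)" for c :: real
  proof (cases "c \<ge> 0")
    case True
    have "{x. 0 \<le> x \<and> x < c} = {0..<c}" by auto
    with True show ?thesis by simp
  next
    case False
    then have "{x. 0 \<le> x \<and> x < c} = {}" by auto
    with False show ?thesis by (simp add: ennreal_neg)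
  qed
  have "(\<integral>\<^sup>+t. ennreal (h t) \<partial>\<nu>) = (\<integral>\<^sup>+t. (\<integral>\<^sup>+x. indicator {x. 0 \<le> x \<and> x < h t} x \<partial>lborel) \<partial>\<nu>)"
    by (simp add: layer)
  also have "\<dots> = (\<integral>\<^sup>+x. (\<integral>\<^sup>+t. indicator {x. 0 \<le> x \<and> x < h t} x \<partial>\<nu>) \<partial>lborel)"
    by (rule Fubini') (simp add: split_beta', measurable)
  also have "\<dots> = (\<integral>\<^sup>+x. indicator {0..} x * emeasure \<nu> {t \<in> space \<nu>. x < h t} \<partial>lborel)"
  proof (intro nn_integral_cong)
    fix x :: real
    have "(\<integral>\<^sup>+t. indicator {x. 0 \<le> x \<and> x < h t} x \<partial>\<nu>)
        = (\<integral>\<^sup>+t. indicator {0..} x * indicator {t \<in> space \<nu>. x < h t} t \<partial>\<nu>)"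
      by (intro nn_integral_cong) (auto simp: indicator_def)
    then show "(\<integral>\<^sup>+t. indicator {x. 0 \<le> x \<and> x < h t} x \<partial>\<nu>)
        = indicator {0..} x * emeasure \<nu> {t \<in> space \<nu>. x < h t}"
      by (simp add: nn_integral_cmult)
  qed
  also have "\<dots> \<le> (\<integral>\<^sup>+x. indicator {0..} x * (ennreal K * emeasure lborel {t \<in> {0..<1}. x < h t}) \<partial>lborel)"
    by (intro nn_integral_mono mult_left_mono bound) auto
  also have "\<dots> = (\<integral>\<^sup>+x. ennreal K * (\<integral>\<^sup>+t. indicator {x. 0 \<le> x \<and> x < h t} x * indicator {0..<1} t \<partial>lborel) \<partial>lborel)"
  proof (intro nn_integral_cong)
    fix x :: real
    have "(\<integral>\<^sup>+t. indicator {x. 0 \<le> x \<and> x < h t} x * indicator {0..<1} t \<partial>lborel)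
        = (\<integral>\<^sup>+t. indicator {0..} x * indicator {t \<in> {0..<1}. x < h t} t \<partial>lborel)"
      by (intro nn_integral_cong) (auto simp: indicator_def)
    then show "indicator {0..} x * (ennreal K * emeasure lborel {t \<in> {0..<1}. x < h t})
        = ennreal K * (\<integral>\<^sup>+t. indicator {x. 0 \<le> x \<and> x < h t} x * indicator {0..<1} t \<partial>lborel)"
      by (simp add: nn_integral_cmult ac_simps)
  qed
  also have "\<dots> = ennreal K * (\<integral>\<^sup>+x. (\<integral>\<^sup>+t. indicator {x. 0 \<le> x \<and> x < h t} x * indicator {0..<1} t \<partial>lborel) \<partial>lborel)"
    by (rule nn_integral_cmult) measurable
  also have "(\<integral>\<^sup>+x. (\<integral>\<^sup>+t. indicator {x. 0 \<le> x \<and> x < h t} x * indicator {0..<1} t \<partial>lborel) \<partial>lborel)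
      = (\<integral>\<^sup>+t. (\<integral>\<^sup>+x. indicator {x. 0 \<le> x \<and> x < h t} x * indicator {0..<1} t \<partial>lborel) \<partial>lborel)"
    by (rule lborel_pair.Fubini'[symmetric]) (simp add: split_beta', measurable)
  also have "\<dots> = (\<integral>\<^sup>+t\<in>{0..<1}. ennreal (h t) \<partial>lborel)"
    by (intro nn_integral_cong) (simp add: nn_integral_multc layer)
  finally show ?thesis .
qed

text \<open>The substitution \<open>u = sqrt (1 - t)\<close> gives \<open>2 du / (u\<^sup>2 + d)\<close>. The integrand is unbounded at \<open>1\<close>, but
  the antiderivative is continuous up to the endpoint.\<close>

lemma has_integral_arctan_kernel:
  assumes d: "d > 0"
  shows "((\<lambda>t. 1 / (sqrt (1 - t) * (1 - t + d))) has_integral (2 / sqrt d * arctan (1 / sqrt d))) {0..1}"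
proof -
  define F where "F = (\<lambda>t. - (2 / sqrt d) * arctan (sqrt (1 - t) / sqrt d))"
  have "((\<lambda>t. 1 / (sqrt (1 - t) * (1 - t + d))) has_integral F 1 - F 0) {0..1}"
  proof (rule fundamental_theorem_of_calculus_interior)
    show "continuous_on {0..1} F"
      unfolding F_def by (intro continuous_intros) (use d in auto)
    fix t :: real assume t: "t \<in> {0<..<1}"
    define s where "s = sqrt (1 - t)"
    define e where "e = sqrt d"
    have s: "s > 0" "s\<^sup>2 = 1 - t" using t by (auto simp: s_def)
    have e: "e > 0" "e\<^sup>2 = d" using d by (auto simp: e_def)
    have sde: "1 + (s / e)\<^sup>2 = (s\<^sup>2 + e\<^sup>2) / e\<^sup>2"
      using e(1) by (simp add: field_simps)
    define p where "p = s\<^sup>2 + e\<^sup>2"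
    have pos: "p > 0" using e(1) by (simp add: p_def add_nonneg_pos)
    have "((\<lambda>t. sqrt (1 - t)) has_real_derivative - (inverse s / 2)) (at t)"
      unfolding s_def using t by (auto intro!: derivative_eq_intros)
    from DERIV_cmult[OF DERIV_chain2[OF DERIV_arctan DERIV_cdivide[OF this, of e]], of "- (2 / e)"]
    have "(F has_real_derivative - (2 / e) * (inverse (1 + (s / e)\<^sup>2) * (- (inverse s / 2) / e))) (at t)"
      by (simp only: F_def s_def e_def)
    also have "- (2 / e) * (inverse (1 + (s / e)\<^sup>2) * (- (inverse s / 2) / e)) = 1 / (s * (s\<^sup>2 + e\<^sup>2))"
      unfolding sde p_def[symmetric] using s(1) e(1) pos by (simp add: field_simps power2_eq_square)
    finally show "(F has_vector_derivative 1 / (sqrt (1 - t) * (1 - t + d))) (at t)"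
      by (simp add: has_real_derivative_iff_has_vector_derivative s(2) e(2) flip: s_def)
  qed auto
  then show ?thesis by (simp add: F_def)
qed

text \<open>The integrand dominates \<open>1 / (|1 - t a| (1 - t\<^sup>2)\<^sup>1\<^sup>/\<^sup>2)\<close> up to a factor when \<open>d = 1 - |a|\<close>, and has the
  advantage of being increasing in \<open>t\<close>. The power \<open>d\<^sup>-\<^sup>1\<^sup>/\<^sup>2\<close> is compensated by the factor
  \<open>(1 - |a|\<^sup>2)\<^sup>1\<^sup>/\<^sup>2\<close> in the norm of the kernel.\<close>

lemma carleson_kernel_integral_le:
  fixes \<nu> :: "real measure"
  assumes sets: "sets \<nu> = sets (restrict_space borel {0..<1})"
    and K: "K \<ge> 0" "\<And>t. t \<in> {0..<1} \<Longrightarrow> emeasure \<nu> {t..<1} \<le> ennreal (K * (1 - t))"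
    and d: "d > 0"
  shows "(\<integral>\<^sup>+t. ennreal (1 / (sqrt (1 - t) * (1 - t + d))) \<partial>\<nu>) \<le> ennreal (K * (pi / sqrt d))"
proof -
  let ?h = "\<lambda>t. 1 / (sqrt (1 - t) * (1 - t + d))"
  have "mono_on {0..<1} ?h"
    using d by (intro mono_onI divide_left_mono mult_mono) (auto intro!: mult_pos_pos)
  then have "(\<integral>\<^sup>+t. ennreal (?h t) \<partial>\<nu>) \<le> ennreal K * (\<integral>\<^sup>+t\<in>{0..<1}. ennreal (?h t) \<partial>lborel)"
    by (intro carleson_nn_integral_mono_le[OF sets K]) auto
  also have "(\<integral>\<^sup>+t\<in>{0..<1}. ennreal (?h t) \<partial>lborel) \<le> (\<integral>\<^sup>+t\<in>{0..1}. ennreal (?h t) \<partial>lborel)"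
    by (intro nn_integral_mono) (auto simp: indicator_def)
  also have "\<dots> = ennreal (2 / sqrt d * arctan (1 / sqrt d))"
    using d by (intro nn_integral_has_integral_lebesgue' has_integral_arctan_kernel) auto
  also have "\<dots> \<le> ennreal (pi / sqrt d)"
    using d arctan_ubound[of "1 / sqrt d"] by (intro ennreal_leI) (simp add: field_simps)
  finally show ?thesis
    by (simp only: ennreal_mult'[OF K(1)] mult_left_mono zero_le)
qed

section \<open>Minkowski's integral inequality and means over circles\<close>

text \<open>Minkowski's inequality \<open>\<parallel>\<integral> k(\<cdot>, y) dN\<parallel>\<^sub>2 \<le> \<integral> \<parallel>k(\<cdot>, y)\<parallel>\<^sub>2 dN\<close>, with a positive bound \<open>c\<close> in place of
  the inner norm. Splitting \<open>k = (k / sqrt c) sqrt c\<close>, the Cauchy-Schwarz inequality and Tonelli give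
  the result at once.\<close>

lemma nn_integral_Minkowski_weighted:
  fixes k :: "'a \<Rightarrow> 'b \<Rightarrow> ennreal" and c :: "'b \<Rightarrow> real"
  assumes "sigma_finite_measure M" "sigma_finite_measure N"
    and k[measurable]: "case_prod k \<in> borel_measurable (M \<Otimes>\<^sub>M N)"
    and c[measurable]: "c \<in> borel_measurable N"
    and pos: "\<And>y. y \<in> space N \<Longrightarrow> c y > 0"
    and le: "\<And>y. y \<in> space N \<Longrightarrow> (\<integral>\<^sup>+x. (k x y)\<^sup>2 \<partial>M) \<le> ennreal ((c y)\<^sup>2)"
  shows "(\<integral>\<^sup>+x. (\<integral>\<^sup>+y. k x y \<partial>N)\<^sup>2 \<partial>M) \<le> (\<integral>\<^sup>+y. ennreal (c y) \<partial>N)\<^sup>2"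
proof -
  interpret M: sigma_finite_measure M by fact
  interpret N: sigma_finite_measure N by fact
  interpret pair_sigma_finite M N ..
  define C where "C = (\<integral>\<^sup>+y. ennreal (c y) \<partial>N)"
  have kx: "k x \<in> borel_measurable N" if "x \<in> space M" for x
    using measurable_compose[OF measurable_Pair1'[OF that] k] by simp
  have ky: "(\<lambda>x. k x y) \<in> borel_measurable M" if "y \<in> space N" for y
    using measurable_compose[OF measurable_Pair2'[OF that] k] by simp
  have "(\<integral>\<^sup>+y. k x y \<partial>N)\<^sup>2 \<le> (\<integral>\<^sup>+y. (k x y)\<^sup>2 * ennreal (1 / c y) \<partial>N) * C" if x: "x \<in> space M" for x
  proof -
    note [measurable] = kx[OF x]
    have "(\<integral>\<^sup>+y. k x y \<partial>N) = (\<integral>\<^sup>+y. (k x y * ennreal (1 / sqrt (c y))) * ennreal (sqrt (c y)) \<partial>N)"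
    proof (intro nn_integral_cong)
      fix y assume "y \<in> space N"
      then have "ennreal (1 / sqrt (c y)) * ennreal (sqrt (c y)) = 1"
        using pos[of y] by (subst ennreal_mult[symmetric]) auto
      then show "k x y = (k x y * ennreal (1 / sqrt (c y))) * ennreal (sqrt (c y))"
        by (simp add: mult.assoc)
    qed
    also have "\<dots>\<^sup>2 \<le> (\<integral>\<^sup>+y. (k x y * ennreal (1 / sqrt (c y)))\<^sup>2 \<partial>N) * (\<integral>\<^sup>+y. (ennreal (sqrt (c y)))\<^sup>2 \<partial>N)"
      by (rule Cauchy_Schwarz_nn_integral) measurable
    also have "(\<integral>\<^sup>+y. (k x y * ennreal (1 / sqrt (c y)))\<^sup>2 \<partial>N) = (\<integral>\<^sup>+y. (k x y)\<^sup>2 * ennreal (1 / c y) \<partial>N)"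
      using pos by (intro nn_integral_cong)
        (simp add: power_mult_distrib ennreal_power power_divide less_imp_le)
    also have "(\<integral>\<^sup>+y. (ennreal (sqrt (c y)))\<^sup>2 \<partial>N) = C"
      unfolding C_def using pos by (intro nn_integral_cong) (simp add: ennreal_power less_imp_le)
    finally show ?thesis .
  qed
  then have "(\<integral>\<^sup>+x. (\<integral>\<^sup>+y. k x y \<partial>N)\<^sup>2 \<partial>M) \<le> (\<integral>\<^sup>+x. (\<integral>\<^sup>+y. (k x y)\<^sup>2 * ennreal (1 / c y) \<partial>N) * C \<partial>M)"
    by (intro nn_integral_mono)
  also have "\<dots> = (\<integral>\<^sup>+x. (\<integral>\<^sup>+y. (k x y)\<^sup>2 * ennreal (1 / c y) \<partial>N) \<partial>M) * C"
    by (rule nn_integral_multc) measurable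
  also have "(\<integral>\<^sup>+x. (\<integral>\<^sup>+y. (k x y)\<^sup>2 * ennreal (1 / c y) \<partial>N) \<partial>M)
      = (\<integral>\<^sup>+y. (\<integral>\<^sup>+x. (k x y)\<^sup>2 * ennreal (1 / c y) \<partial>M) \<partial>N)"
    by (rule Fubini'[symmetric]) measurable
  also have "\<dots> \<le> C"
    unfolding C_def
  proof (rule nn_integral_mono)
    fix y assume y: "y \<in> space N"
    note [measurable] = ky[OF y]
    have "(\<integral>\<^sup>+x. (k x y)\<^sup>2 * ennreal (1 / c y) \<partial>M) = (\<integral>\<^sup>+x. (k x y)\<^sup>2 \<partial>M) * ennreal (1 / c y)"
      by (rule nn_integral_multc) measurable
    also have "\<dots> \<le> ennreal ((c y)\<^sup>2) * ennreal (1 / c y)"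
      by (intro mult_right_mono le y) simp
    also have "\<dots> = ennreal (c y)"
      using pos[OF y] by (subst ennreal_mult[symmetric]) (auto simp: power2_eq_square)
    finally show "(\<integral>\<^sup>+x. (k x y)\<^sup>2 * ennreal (1 / c y) \<partial>M) \<le> ennreal (c y)" .
  qed
  finally show ?thesis
    by (simp add: C_def power2_eq_square mult_right_mono)
qed

lemma has_integral_circle_mean:
  assumes "continuous_on (cball 0 r) f" "f holomorphic_on ball 0 r" "r > 0"
  shows "((\<lambda>\<theta>. f (of_real r * cis \<theta>)) has_integral 2 * of_real pi * f 0) {0..2 * pi}"
proof -
  have "((\<lambda>u. f u / (u - 0)) has_contour_integral (2 * of_real pi * \<i> * f 0)) (circlepath 0 r)"
    using assms by (intro Cauchy_integral_circlepath) auto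
  then have "((\<lambda>\<theta>. f (of_real r * cis \<theta>) / (of_real r * cis \<theta>) * r * \<i> * cis \<theta>)
      has_integral 2 * of_real pi * \<i> * f 0) {0..2 * pi}"
    unfolding circlepath_def by (subst (asm) has_contour_integral_part_circlepath_iff) auto
  from has_integral_mult_right[OF this, of "- \<i>"] show ?thesis
    using assms(3) by (simp add: mult_ac)
qed

lemma has_integral_circle_deriv:
  assumes "f holomorphic_on ball 0 1" "0 < r" "r < 1"
  shows "((\<lambda>\<theta>. f (of_real r * cis \<theta>) / (of_real r * cis \<theta>)) has_integral 2 * of_real pi * deriv f 0) {0..2 * pi}"
proof -
  have "continuous_on (cball 0 r) f" "f holomorphic_on ball 0 r"
    using assms by (auto intro!: holomorphic_on_imp_continuous_on intro: holomorphic_on_subset)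
  then have "((\<lambda>u. f u / u\<^sup>2) has_contour_integral (2 * of_real pi * \<i> * deriv f 0)) (circlepath 0 r)"
    using Cauchy_has_contour_integral_higher_derivative_circlepath[of 0 r f 0 1] assms
    by (simp add: numeral_2_eq_2)
  then have "((\<lambda>\<theta>. f (of_real r * cis \<theta>) / (of_real r * cis \<theta>)\<^sup>2 * r * \<i> * cis \<theta>)
      has_integral 2 * of_real pi * \<i> * deriv f 0) {0..2 * pi}"
    unfolding circlepath_def by (subst (asm) has_contour_integral_part_circlepath_iff) (auto simp: power2_eq_square)
  from has_integral_mult_right[OF this, of "- \<i>"] show ?thesis
    using assms(2) by (simp add: mult_ac power2_eq_square)
qed

text \<open>Cauchy's formula bounds the derivative by the \<open>L\<^sup>1\<close> mean over the circle. The \<open>L\<^sup>1\<close> mean is at most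
  the \<open>L\<^sup>2\<close> mean by \<open>x \<le> A / 2 + x\<^sup>2 / (2 A)\<close>, which is optimal for \<open>A\<close> equal to the latter.\<close>

lemma norm_deriv_0_le_circle_mean2:
  assumes f: "f holomorphic_on ball 0 1" and r: "0 < r" "r < 1"
  shows "norm (deriv f 0) \<le> circle_mean2 r f / r"
proof -
  define I where "I = integral {0..2 * pi} (\<lambda>\<theta>. (norm (f (of_real r * cis \<theta>)))\<^sup>2)"
  have cont: "continuous_on {0..2 * pi} (\<lambda>\<theta>. f (of_real r * cis \<theta>))"
    by (rule continuous_on_circle[OF f r])
  have int: "((\<lambda>\<theta>. (norm (f (of_real r * cis \<theta>)))\<^sup>2) has_integral I) {0..2 * pi}"
    unfolding I_def by (intro integrable_integral integrable_continuous_interval continuous_intros cont)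
  have "circle_mean2 r f \<ge> r * norm (deriv f 0)"
  proof (rule field_le_epsilon)
    fix e :: real assume e: "e > 0"
    \<comment> \<open>The summand \<open>e\<close> keeps \<open>A\<close> positive also when the mean vanishes.\<close>
    define A where "A = circle_mean2 r f + e"
    have A: "A > 0" using e circle_mean2_nonneg[of r f] by (simp add: A_def add_nonneg_pos)
    have I: "I \<le> 2 * pi * A\<^sup>2"
    proof -
      have "I \<ge> 0" using int by (rule has_integral_nonneg) auto
      then have "I = 2 * pi * (circle_mean2 r f)\<^sup>2" by (simp add: circle_mean2_def I_def)
      then show ?thesis using circle_mean2_nonneg[of r f] e
        by (simp add: A_def power_mono)
    qed
    have "((\<lambda>\<theta>. 1 / r * (A / 2 + 1 / (2 * A) * (norm (f (of_real r * cis \<theta>)))\<^sup>2)) has_integral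
        1 / r * (2 * pi * (A / 2) + 1 / (2 * A) * I)) {0..2 * pi}"
      by (intro has_integral_mult_right has_integral_add int)
        (use has_integral_const_real[of "A / 2" 0 "2 * pi"] in simp)
    moreover have "norm (f (of_real r * cis \<theta>) / (of_real r * cis \<theta>))
        \<le> 1 / r * (A / 2 + 1 / (2 * A) * (norm (f (of_real r * cis \<theta>)))\<^sup>2)" for \<theta>
    proof -
      define x where "x = norm (f (of_real r * cis \<theta>))"
      have "A / 2 + 1 / (2 * A) * x\<^sup>2 - x = (A - x)\<^sup>2 / (2 * A)"
        using A by (simp add: field_simps power2_eq_square)
      also have "\<dots> \<ge> 0" using A by simp
      finally show ?thesis using r
        by (simp add: norm_divide norm_mult x_def[symmetric] divide_simps)
    qed
    ultimately have "norm (2 * of_real pi * deriv f 0) \<le> 1 / r * (2 * pi * (A / 2) + 1 / (2 * A) * I)"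
      using integral_norm_bound_integral has_integral_circle_deriv[OF f r]
      by (metis (no_types, lifting) has_integral_iff)
    also have "\<dots> \<le> 1 / r * (2 * pi * (A / 2) + 1 / (2 * A) * (2 * pi * A\<^sup>2))"
      using r A I by (intro mult_left_mono add_left_mono) auto
    also have "\<dots> = 2 * pi * (A / r)"
      using A by (simp add: power2_eq_square field_simps)
    finally show "r * norm (deriv f 0) \<le> circle_mean2 r f + e"
      using r unfolding A_def[symmetric] by (simp add: norm_mult field_simps)
  qed
  then show ?thesis using r by (simp add: field_simps)
qed

text \<open>Up to the factor \<open>1 - |b|\<^sup>2\<close> the integrand is the real part of the holomorphic function
  \<open>(1 + b z) / (1 - b z)\<close>, whose mean over the unit circle is its value \<open>1\<close> at the centre.\<close>

lemma has_integral_Poisson_kernel: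
  assumes b: "norm b < 1"
  shows "((\<lambda>\<theta>. 1 / (norm (1 - b * cis \<theta>))\<^sup>2) has_integral 2 * pi / (1 - (norm b)\<^sup>2)) {0..2 * pi}"
proof -
  have nz: "1 - b * z \<noteq> 0" if "norm z \<le> 1" for z
  proof -
    have "norm (b * z) \<le> norm b * 1" unfolding norm_mult using that by (intro mult_left_mono) auto
    then show ?thesis using b by auto
  qed
  have "((\<lambda>\<theta>. (\<lambda>z. (1 + b * z) / (1 - b * z)) (of_real 1 * cis \<theta>)) has_integral
      2 * of_real pi * (\<lambda>z. (1 + b * z) / (1 - b * z)) 0) {0..2 * pi}"
    using nz by (intro has_integral_circle_mean continuous_intros holomorphic_intros) auto
  then have "((\<lambda>\<theta>. (1 + b * cis \<theta>) / (1 - b * cis \<theta>)) has_integral of_real (2 * pi)) {0..2 * pi}"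
    by simp
  from has_integral_Re[OF this]
  have "((\<lambda>\<theta>. Re ((1 + b * cis \<theta>) / (1 - b * cis \<theta>))) has_integral 2 * pi) {0..2 * pi}" by simp
  moreover have "Re ((1 + b * cis \<theta>) / (1 - b * cis \<theta>)) = (1 - (norm b)\<^sup>2) * (1 / (norm (1 - b * cis \<theta>))\<^sup>2)" for \<theta>
  proof -
    define u where "u = b * cis \<theta>"
    have u: "norm u = norm b" by (simp add: u_def norm_mult)
    show ?thesis
      unfolding u_def[symmetric] u[symmetric]
      unfolding Re_divide cmod_power2 by (simp add: power2_eq_square algebra_simps)
  qed
  ultimately have *: "((\<lambda>\<theta>. (1 - (norm b)\<^sup>2) * (1 / (norm (1 - b * cis \<theta>))\<^sup>2)) has_integral 2 * pi) {0..2 * pi}"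
    by simp
  have "1 - (norm b)\<^sup>2 > 0" using b by (simp add: abs_square_less_1)
  with has_integral_mult_right[OF *, of "1 / (1 - (norm b)\<^sup>2)"] show ?thesis by simp
qed

section \<open>The Cauchy kernel under disc automorphisms\<close>

text \<open>Here \<open>1 - t \<phi>\<^sub>a(w) = (1 - t a) (1 - b w) / (1 - cnj a w)\<close>, so the pulled back kernel has again
  a single pole, at \<open>1 / b\<close> with \<open>b\<close> in the disc, and subtracting its value at \<open>0\<close> leaves the factor \<open>w\<close>.\<close>

lemma disc_aut_pullback_kernel:
  fixes t :: real
  assumes a: "norm a < 1" and t: "t \<in> {0..<1}" and w: "norm w < 1"
  defines "b \<equiv> (cnj a - of_real t) / (1 - of_real t * a)"
  shows "1 / (1 - of_real t * disc_aut a w) - 1 / (1 - of_real t * a)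
    = - (of_real (t * (1 - (norm a)\<^sup>2)) / (1 - of_real t * a)\<^sup>2) * (w / (1 - b * w))"
    and "1 - (norm b)\<^sup>2 = (1 - (norm a)\<^sup>2) * (1 - t\<^sup>2) / (norm (1 - of_real t * a))\<^sup>2"
    and "norm b < 1"
proof -
  define u where "u = 1 - of_real t * a"
  have nt: "norm (of_real t * z) < 1" if "norm z < 1" for z :: complex
  proof -
    have "t * norm z \<le> norm z" using t by (intro mult_left_le_one_le) auto
    then show ?thesis using t that by (simp add: norm_mult)
  qed
  have u: "u \<noteq> 0" using nt[OF a] by (auto simp: u_def)
  have v: "1 - cnj a * w \<noteq> 0" "norm (disc_aut a w) < 1"
    using disc_aut_in_disc[OF a w] by auto
  have na: "of_real ((norm a)\<^sup>2) = a * cnj a"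
    by (rule complex_norm_square)
  have "(norm u)\<^sup>2 - (norm (cnj a - of_real t))\<^sup>2 = (1 - (norm a)\<^sup>2) * (1 - t\<^sup>2)"
    unfolding u_def cmod_power2 by (simp add: power2_eq_square algebra_simps)
  moreover have "(norm b)\<^sup>2 = (norm (cnj a - of_real t))\<^sup>2 / (norm u)\<^sup>2"
    by (simp add: b_def u_def norm_divide power_divide)
  ultimately show b: "1 - (norm b)\<^sup>2 = (1 - (norm a)\<^sup>2) * (1 - t\<^sup>2) / (norm (1 - of_real t * a))\<^sup>2"
    unfolding u_def[symmetric] using u by (simp add: field_simps)
  have "\<dots> > 0"
    using a t u by (auto intro!: divide_pos_pos mult_pos_pos simp: u_def abs_square_less_1)
  with b have "(norm b)\<^sup>2 < 1" by simp
  then show b1: "norm b < 1" by (simp add: abs_square_less_1)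
  have bw: "1 - b * w \<noteq> 0"
    using mult_strict_mono'[OF b1 w] norm_mult[of b w] by auto
  have bu: "b * u = cnj a - of_real t" using u by (simp add: b_def u_def)
  have den: "(1 - of_real t * disc_aut a w) * (1 - cnj a * w) = u * (1 - b * w)"
  proof -
    have "(1 - of_real t * disc_aut a w) * (1 - cnj a * w) = (1 - cnj a * w) - of_real t * (a - w)"
      using v(1) by (simp add: disc_aut_def field_simps)
    also have "\<dots> = u - (cnj a - of_real t) * w" by (simp add: u_def algebra_simps)
    also have "\<dots> = u * (1 - b * w)" by (simp add: bu[symmetric] algebra_simps)
    finally show ?thesis .
  qed
  have "1 / (1 - of_real t * disc_aut a w) = (1 - cnj a * w) / (u * (1 - b * w))"
    using den v(1) u bw by (metis div_self mult_eq_0_iff nonzero_mult_divide_mult_cancel_right mult_1)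
  moreover have "1 / u = (1 - b * w) / (u * (1 - b * w))" using u bw by simp
  ultimately have "1 / (1 - of_real t * disc_aut a w) - 1 / u = ((1 - cnj a * w) - (1 - b * w)) / (u * (1 - b * w))"
    by (simp only: diff_divide_distrib)
  also have "\<dots> = (b - cnj a) * u * w / (u\<^sup>2 * (1 - b * w))"
    using u bw by (simp add: field_simps power2_eq_square)
  also have "(b - cnj a) * u = - of_real (t * (1 - (norm a)\<^sup>2))"
    unfolding left_diff_distrib bu of_real_mult of_real_diff na by (simp add: u_def algebra_simps)
  finally show "1 / (1 - of_real t * disc_aut a w) - 1 / (1 - of_real t * a)
    = - (of_real (t * (1 - (norm a)\<^sup>2)) / (1 - of_real t * a)\<^sup>2) * (w / (1 - b * w))"
    by (simp add: u_def)
qed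

text \<open>At \<open>w = r cis \<theta>\<close> the difference has modulus \<open>|q| / |1 - r b cis \<theta>|\<close> with \<open>q\<close> independent of \<open>\<theta>\<close>,
  so the Poisson integral gives its mean square. The bound follows from \<open>1 - |a|\<^sup>2 \<le> 2 d\<close>, \<open>1 - t\<^sup>2 \<ge> 1 - t\<close> and
  \<open>|1 - t a| \<ge> (1 - t + d) / 2\<close>, the last because \<open>1 - t |a|\<close> is at least \<open>1 - t\<close> and at least \<open>1 - |a|\<close>.\<close>

lemma kernel_circle_mean_le:
  fixes t r :: real
  assumes a: "norm a < 1" and t: "t \<in> {0..<1}" and r: "r \<in> {0<..<1}"
  defines "d \<equiv> 1 - norm a"
  shows "(\<integral>\<^sup>+\<theta>\<in>{0..2 * pi}. ennreal ((norm (1 / (1 - of_real t * disc_aut a (of_real r * cis \<theta>))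
      - 1 / (1 - of_real t * a)))\<^sup>2) \<partial>lborel) \<le> ennreal (16 * pi * d * (1 / (sqrt (1 - t) * (1 - t + d)))\<^sup>2)"
proof -
  define b where "b = (cnj a - of_real t) / (1 - of_real t * a)"
  define n where "n = norm (1 - of_real t * a)"
  define q where "q = t * (1 - (norm a)\<^sup>2) / n\<^sup>2 * r"
  note ker = disc_aut_pullback_kernel[OF a t, folded b_def]
  have b: "norm b < 1" "1 - (norm b)\<^sup>2 = (1 - (norm a)\<^sup>2) * (1 - t\<^sup>2) / n\<^sup>2"
    using ker(2,3)[of 0] by (auto simp: n_def)
  have d: "d > 0" "norm a = 1 - d" "d \<le> 1" using a by (auto simp: d_def)
  have rb: "norm (of_real r * b) < 1" "norm (of_real r * b) \<le> norm b"
    using r b(1) by (auto simp: norm_mult mult_left_le_one_le intro: le_less_trans[OF mult_left_le_one_le])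
  have n: "n \<ge> (1 - t + d) / 2"
  proof -
    have "1 - t * norm a \<le> n"
      using norm_triangle_ineq2[of 1 "of_real t * a"] t by (simp add: n_def norm_mult)
    moreover have "t * norm a \<le> t" "t * norm a \<le> norm a"
      using t a by (auto intro: mult_right_le_one_le mult_left_le_one_le)
    ultimately show ?thesis by (simp add: d_def)
  qed
  have n0: "n > 0" using n t d by auto
  have eq: "(norm (1 / (1 - of_real t * disc_aut a (of_real r * cis \<theta>)) - 1 / (1 - of_real t * a)))\<^sup>2
      = q\<^sup>2 * (1 / (norm (1 - (of_real r * b) * cis \<theta>))\<^sup>2)" for \<theta>
  proof -
    have "norm (of_real r * cis \<theta>) < 1" using r by (simp add: norm_mult)
    note k = ker(1)[OF this]
    have "norm (1 / (1 - of_real t * disc_aut a (of_real r * cis \<theta>)) - 1 / (1 - of_real t * a))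
        = \<bar>q\<bar> * (1 / norm (1 - (of_real r * b) * cis \<theta>))"
      unfolding k using r by (simp add: norm_mult norm_divide norm_power q_def n_def abs_mult mult_ac flip: of_real_mult)
    then show ?thesis by (simp add: power_mult_distrib power_divide)
  qed
  have "((\<lambda>\<theta>. q\<^sup>2 * (1 / (norm (1 - (of_real r * b) * cis \<theta>))\<^sup>2)) has_integral
      q\<^sup>2 * (2 * pi / (1 - (norm (of_real r * b))\<^sup>2))) {0..2 * pi}"
    by (intro has_integral_mult_right has_integral_Poisson_kernel rb)
  then have "(\<integral>\<^sup>+\<theta>\<in>{0..2 * pi}. ennreal ((norm (1 / (1 - of_real t * disc_aut a (of_real r * cis \<theta>))
      - 1 / (1 - of_real t * a)))\<^sup>2) \<partial>lborel) = ennreal (q\<^sup>2 * (2 * pi / (1 - (norm (of_real r * b))\<^sup>2)))"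
    unfolding eq by (intro nn_integral_has_integral_lebesgue') auto
  also have "\<dots> \<le> ennreal (16 * pi * d * (1 / (sqrt (1 - t) * (1 - t + d)))\<^sup>2)"
  proof (rule ennreal_leI)
    have a2: "1 - (norm a)\<^sup>2 > 0" using a by (simp add: abs_square_less_1)
    have t2: "1 - t\<^sup>2 > 0" using t by (simp add: abs_square_less_1)
    have bp: "1 - (norm b)\<^sup>2 > 0" using b(1) by (simp add: abs_square_less_1)
    have rb2: "(norm (of_real r * b))\<^sup>2 \<le> (norm b)\<^sup>2" using rb(2) by (intro power_mono) auto
    have "\<bar>q\<bar> \<le> (1 - (norm a)\<^sup>2) / n\<^sup>2"
    proof -
      have "(t * r) * ((1 - (norm a)\<^sup>2) / n\<^sup>2) \<le> (1 - (norm a)\<^sup>2) / n\<^sup>2"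
        using t r a2 by (intro mult_left_le_one_le) (auto intro: mult_le_one)
      moreover have "q = (t * r) * ((1 - (norm a)\<^sup>2) / n\<^sup>2)" by (simp add: q_def)
      moreover have "q \<ge> 0" using t r a2 by (simp add: q_def)
      ultimately show ?thesis by simp
    qed
    then have "q\<^sup>2 \<le> ((1 - (norm a)\<^sup>2) / n\<^sup>2)\<^sup>2"
      by (metis abs_ge_zero power2_abs power_mono)
    then have "q\<^sup>2 * (2 * pi / (1 - (norm (of_real r * b))\<^sup>2)) \<le> ((1 - (norm a)\<^sup>2) / n\<^sup>2)\<^sup>2 * (2 * pi / (1 - (norm b)\<^sup>2))"
      using bp rb2 rb(1) by (intro mult_mono divide_left_mono mult_pos_pos divide_nonneg_pos)
        (auto simp: abs_square_less_1)
    also have "\<dots> = 2 * pi * (1 - (norm a)\<^sup>2) / ((1 - t\<^sup>2) * n\<^sup>2)"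
    proof -
      have "(A / n\<^sup>2)\<^sup>2 * (2 * pi / (A * T / n\<^sup>2)) = 2 * pi * A / (T * n\<^sup>2)" if "A > 0" "T > 0" for A T
        using that n0 by (simp add: field_simps power2_eq_square)
      then show ?thesis unfolding b(2) using a2 t2 by blast
    qed
    also have "\<dots> \<le> 2 * pi * (2 * d) / ((1 - t) * ((1 - t + d) / 2)\<^sup>2)"
    proof (intro frac_le mult_left_mono mult_mono power_mono n)
      show "1 - (norm a)\<^sup>2 \<le> 2 * d"
        unfolding d(2) by (simp add: power2_eq_square algebra_simps)
      show "1 - t \<le> 1 - t\<^sup>2" using t by (simp add: power2_eq_square mult_left_le)
    qed (use t d t2 in auto)
    also have "\<dots> = 16 * pi * d * (1 / (sqrt (1 - t) * (1 - t + d)))\<^sup>2"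
      using t by (simp add: power_mult_distrib power_divide)
    finally show "q\<^sup>2 * (2 * pi / (1 - (norm (of_real r * b))\<^sup>2)) \<le> 16 * pi * d * (1 / (sqrt (1 - t) * (1 - t + d)))\<^sup>2" .
  qed
  finally show ?thesis .
qed

section \<open>The BMOA norm of a Cauchy transform\<close>

lemma
  assumes "borel_measure_on_01 \<mu>"
  shows space_borel_measure_on_01: "space \<mu> = {0..<1}"
    and measurable_ident_borel_measure_on_01: "(\<lambda>t. t) \<in> borel_measurable \<mu>"
    and continuous_measurable_borel_measure_on_01:
      "continuous_on {0..<1} (g :: real \<Rightarrow> complex) \<Longrightarrow> g \<in> borel_measurable \<mu>"
proof -
  have sets: "sets \<mu> = sets (restrict_space borel {0..<1})"
    using assms by (simp add: borel_measure_on_01_def)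
  show "space \<mu> = {0..<1}"
    using sets_eq_imp_space_eq[OF sets] by (simp add: space_restrict_space)
  show "(\<lambda>t. t) \<in> borel_measurable \<mu>"
    unfolding measurable_cong_sets[OF sets refl] by (rule measurable_restrict_space1) simp
  show "g \<in> borel_measurable \<mu>" if "continuous_on {0..<1} g"
    unfolding measurable_cong_sets[OF sets refl]
    by (rule borel_measurable_continuous_on_restrict[OF that])
qed

lemma norm_one_minus_ge:
  fixes z :: complex
  assumes "t \<in> {0..<1}"
  shows "norm (1 - of_real t * z) \<ge> 1 - norm z"
proof -
  have "t * norm z \<le> norm z" using assms by (intro mult_left_le_one_le) auto
  then show ?thesis
    using norm_triangle_ineq2[of 1 "of_real t * z"] assms by (simp add: norm_mult)
qed

lemma integrable_I_op:
  fixes F :: "complex \<Rightarrow> complex"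
  assumes \<mu>: "borel_measure_on_01 \<mu>" and F: "integrable \<mu> (\<lambda>t. F (of_real t))" and z: "norm z < 1"
  shows "integrable \<mu> (\<lambda>t. F (of_real t) / (1 - of_real t * z))"
proof (rule Bochner_Integration.integrable_bound)
  show "integrable \<mu> (\<lambda>t. 1 / (1 - norm z) * norm (F (of_real t)))"
    using F by (intro integrable_mult_right integrable_norm)
  have [measurable]: "(\<lambda>t. F (of_real t)) \<in> borel_measurable \<mu>" "(\<lambda>t. t) \<in> borel_measurable \<mu>"
    using F measurable_ident_borel_measure_on_01[OF \<mu>] by auto
  show "(\<lambda>t. F (of_real t) / (1 - of_real t * z)) \<in> borel_measurable \<mu>"
    by measurable
  show "AE t in \<mu>. norm (F (of_real t) / (1 - of_real t * z)) \<le> norm (1 / (1 - norm z) * norm (F (of_real t)))"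
  proof (rule AE_I2)
    fix t assume "t \<in> space \<mu>"
    then have "norm (1 - of_real t * z) \<ge> 1 - norm z"
      by (intro norm_one_minus_ge) (simp add: space_borel_measure_on_01[OF \<mu>])
    then show "norm (F (of_real t) / (1 - of_real t * z)) \<le> norm (1 / (1 - norm z) * norm (F (of_real t)))"
      using z by (simp add: norm_divide) (intro divide_left_mono mult_pos_pos, auto)
  qed
qed

text \<open>Expanding the Cauchy kernel into a geometric series exhibits \<open>I_op \<mu> F\<close> as the power series whose
  coefficients are the moments of \<open>F d\<mu>\<close>.\<close>

lemma I_op_disc_holomorphic:
  fixes F :: "complex \<Rightarrow> complex"
  assumes \<mu>: "borel_measure_on_01 \<mu>" and F: "integrable \<mu> (\<lambda>t. F (of_real t))"
  shows "I_op \<mu> F \<in> disc_holomorphic"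
proof -
  have [measurable]: "(\<lambda>t. F (of_real t)) \<in> borel_measurable \<mu>" "(\<lambda>t. t) \<in> borel_measurable \<mu>"
    using F measurable_ident_borel_measure_on_01[OF \<mu>] by auto
  note space = space_borel_measure_on_01[OF \<mu>]
  have "I_op \<mu> F holomorphic_on ball 0 1"
  proof (rule power_series_holomorphic)
    fix w :: complex assume "w \<in> ball 0 1"
    then have w: "norm w < 1" by simp
    let ?f = "\<lambda>n t. F (of_real t) * of_real t ^ n * w ^ n"
    have bnd: "norm (?f n t) \<le> norm (F (of_real t)) * norm w ^ n" if "t \<in> space \<mu>" for n t
      using that by (auto simp: space norm_mult norm_power power_le_one mult_right_mono mult_left_le)
    have coeff: "integrable \<mu> (\<lambda>t. F (of_real t) * of_real t ^ n)" for n
      by (rule Bochner_Integration.integrable_bound[OF F])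
        (auto simp: space norm_mult norm_power power_le_one mult_left_le)
    then have int: "integrable \<mu> (?f n)" for n
      by (intro integrable_mult_left)
    have "(\<lambda>n. \<integral>t. ?f n t \<partial>\<mu>) sums (\<integral>t. (\<Sum>n. ?f n t) \<partial>\<mu>)"
    proof (rule sums_integral[OF int])
      show "AE t in \<mu>. summable (\<lambda>n. norm (?f n t))"
      proof (rule AE_I2)
        fix t assume t: "t \<in> space \<mu>"
        have "summable (\<lambda>n. norm (F (of_real t)) * norm w ^ n)"
          using w by (intro summable_mult summable_geometric) auto
        then show "summable (\<lambda>n. norm (?f n t))"
          by (rule summable_comparison_test') (use bnd[OF t] in simp)
      qed
      have "summable (\<lambda>n. (\<integral>t. norm (F (of_real t)) \<partial>\<mu>) * norm w ^ n)"
        using w by (intro summable_mult summable_geometric) auto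
      then show "summable (\<lambda>n. \<integral>t. norm (?f n t) \<partial>\<mu>)"
      proof (rule summable_comparison_test')
        fix n
        have "(\<integral>t. norm (?f n t) \<partial>\<mu>) \<le> (\<integral>t. norm (F (of_real t)) * norm w ^ n \<partial>\<mu>)"
          by (intro integral_mono integrable_norm int integrable_mult_left F bnd)
        then show "norm (\<integral>t. norm (?f n t) \<partial>\<mu>) \<le> (\<integral>t. norm (F (of_real t)) \<partial>\<mu>) * norm w ^ n"
          by simp
      qed
    qed
    moreover have "(\<integral>t. (\<Sum>n. ?f n t) \<partial>\<mu>) = I_op \<mu> F w"
    proof -
      have "(\<Sum>n. ?f n t) = F (of_real t) / (1 - of_real t * w)" if "t \<in> space \<mu>" for t
      proof -
        have "t * norm w \<le> norm w" using that by (intro mult_left_le_one_le) (auto simp: space)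
        then have "norm (of_real t * w) < 1" using w that by (simp add: norm_mult space)
        from sums_mult[OF geometric_sums[OF this], of "F (of_real t)"] show ?thesis
          by (simp add: sums_iff power_mult_distrib mult_ac)
      qed
      then show ?thesis using w
        by (auto simp: I_op_def intro!: Bochner_Integration.integral_cong)
    qed
    moreover have "(\<integral>t. ?f n t \<partial>\<mu>) = (\<integral>t. F (of_real t) * of_real t ^ n \<partial>\<mu>) * (w - 0) ^ n" for n
      by simp
    ultimately show "(\<lambda>n. (\<integral>t. F (of_real t) * of_real t ^ n \<partial>\<mu>) * (w - 0) ^ n) sums I_op \<mu> F w"
      by simp
  qed
  then show ?thesis by (simp add: disc_holomorphic_def I_op_def)
qed

text \<open>Minkowski's inequality for the measure \<open>|F| d\<mu>\<close> combines the mean square bound for the kernel with the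
  Carleson integral \<open>K \<pi> d\<^sup>-\<^sup>1\<^sup>/\<^sup>2\<close>. It yields the bound \<open>8\<^sup>1\<^sup>/\<^sup>2 \<pi> K\<close>, rounded up to \<open>3 \<pi> K\<close>, which is
  independent of \<open>a\<close> and \<open>r\<close>.\<close>

lemma circle_mean2_I_op_le:
  fixes F :: "complex \<Rightarrow> complex"
  assumes \<mu>: "borel_measure_on_01 \<mu>" and F: "integrable \<mu> (\<lambda>t. F (of_real t))"
    and K: "K \<ge> 0" "\<And>t. t \<in> {0..<1} \<Longrightarrow> (\<integral>\<^sup>+s\<in>{t..<1}. ennreal (norm (F (of_real s))) \<partial>\<mu>) \<le> ennreal (K * (1 - t))"
    and a: "norm a < 1" and r: "r \<in> {0<..<1}"
  shows "circle_mean2 r (\<lambda>z. I_op \<mu> F (disc_aut a z) - I_op \<mu> F a) \<le> 3 * pi * K"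
proof -
  have [measurable]: "(\<lambda>t. F (of_real t)) \<in> borel_measurable \<mu>" "(\<lambda>t. t) \<in> borel_measurable \<mu>"
    using F measurable_ident_borel_measure_on_01[OF \<mu>] by auto
  note space = space_borel_measure_on_01[OF \<mu>]
  have sets: "sets \<mu> = sets (restrict_space borel {0..<1})"
    using \<mu> by (simp add: borel_measure_on_01_def)
  define \<nu> where "\<nu> = density \<mu> (\<lambda>t. ennreal (norm (F (of_real t))))"
  have \<nu>: "sets \<nu> = sets (restrict_space borel {0..<1})" "space \<nu> = {0..<1}"
    using sets space by (auto simp: \<nu>_def)
  have [measurable]: "(\<lambda>t. t) \<in> borel_measurable \<nu>"
    by (simp add: \<nu>_def)
  have \<nu>K: "emeasure \<nu> {t..<1} \<le> ennreal (K * (1 - t))" if "t \<in> {0..<1}" for t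
    using K(2)[OF that] that unfolding \<nu>_def
    by (subst emeasure_density) (auto simp: sets sets_restrict_space_iff)
  have "emeasure \<nu> (space \<nu>) \<noteq> \<infinity>"
    using \<nu>K[of 0] by (auto simp: \<nu>(2) top_unique)
  then interpret \<nu>: finite_measure \<nu>
    by (rule finite_measureI)
  define G where "G = (\<lambda>z. I_op \<mu> F (disc_aut a z) - I_op \<mu> F a)"
  define k where "k = (\<lambda>\<theta> t. 1 / (1 - of_real t * disc_aut a (of_real r * cis \<theta>)) - 1 / (1 - of_real t * a))"
  define d where "d = 1 - norm a"
  have d: "d > 0" using a by (simp add: d_def)
  define c where "c = (\<lambda>t. sqrt (16 * pi * d) * (1 / (sqrt (1 - t) * (1 - t + d))))"
  have [measurable]: "cis \<in> borel_measurable borel"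
    by (intro borel_measurable_continuous_onI continuous_intros)
  have G_le: "ennreal (norm (G (of_real r * cis \<theta>))) \<le> (\<integral>\<^sup>+t. ennreal (norm (k \<theta> t)) \<partial>\<nu>)" for \<theta>
  proof -
    define w where "w = disc_aut a (of_real r * cis \<theta>)"
    have w: "norm w < 1"
      unfolding w_def using r by (intro disc_aut_in_disc a) (simp add: norm_mult)
    have "G (of_real r * cis \<theta>) = (\<integral>t. F (of_real t) / (1 - of_real t * w) - F (of_real t) / (1 - of_real t * a) \<partial>\<mu>)"
      using w a unfolding G_def w_def[symmetric]
      by (simp add: I_op_def Bochner_Integration.integral_diff[OF integrable_I_op[OF \<mu> F] integrable_I_op[OF \<mu> F]])
    also have "\<dots> = (\<integral>t. F (of_real t) * k \<theta> t \<partial>\<mu>)"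
      by (simp add: k_def w_def right_diff_distrib)
    also have "ennreal (norm \<dots>) \<le> (\<integral>\<^sup>+t. ennreal (norm (F (of_real t) * k \<theta> t)) \<partial>\<mu>)"
      using w a integrable_I_op[OF \<mu> F, of w] integrable_I_op[OF \<mu> F, of a]
      by (intro integral_norm_bound_ennreal) (simp add: k_def w_def right_diff_distrib)
    also have "\<dots> = (\<integral>\<^sup>+t. ennreal (norm (k \<theta> t)) \<partial>\<nu>)"
      unfolding \<nu>_def by (subst nn_integral_density) (auto simp: norm_mult ennreal_mult k_def)
    finally show ?thesis .
  qed
  have hol: "G holomorphic_on ball 0 1"
    using I_op_disc_holomorphic[OF \<mu> F] a unfolding G_def
    by (intro holomorphic_disc_aut) (auto simp: disc_holomorphic_def)
  define J where "J = integral {0..2 * pi} (\<lambda>\<theta>. (norm (G (of_real r * cis \<theta>)))\<^sup>2)"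
  have J: "((\<lambda>\<theta>. (norm (G (of_real r * cis \<theta>)))\<^sup>2) has_integral J) {0..2 * pi}"
    unfolding J_def using r
    by (intro integrable_integral integrable_continuous_interval continuous_intros continuous_on_circle[OF hol]) auto
  then have J0: "J \<ge> 0" by (rule has_integral_nonneg) auto
  have "ennreal J = (\<integral>\<^sup>+\<theta>\<in>{0..2 * pi}. ennreal ((norm (G (of_real r * cis \<theta>)))\<^sup>2) \<partial>lborel)"
    by (rule nn_integral_has_integral_lebesgue'[OF _ J, symmetric]) simp
  also have "\<dots> \<le> (\<integral>\<^sup>+\<theta>. (\<integral>\<^sup>+t. indicator {0..2 * pi} \<theta> * ennreal (norm (k \<theta> t)) \<partial>\<nu>)\<^sup>2 \<partial>lborel)"
  proof (intro nn_integral_mono)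
    fix \<theta> :: real
    have "ennreal ((norm (G (of_real r * cis \<theta>)))\<^sup>2) \<le> (\<integral>\<^sup>+t. ennreal (norm (k \<theta> t)) \<partial>\<nu>)\<^sup>2"
      using power_mono[OF G_le[of \<theta>], where n = 2] by (simp add: ennreal_power)
    then show "ennreal ((norm (G (of_real r * cis \<theta>)))\<^sup>2) * indicator {0..2 * pi} \<theta>
        \<le> (\<integral>\<^sup>+t. indicator {0..2 * pi} \<theta> * ennreal (norm (k \<theta> t)) \<partial>\<nu>)\<^sup>2"
      by (auto simp: indicator_def)
  qed
  also have "\<dots> \<le> (\<integral>\<^sup>+t. ennreal (c t) \<partial>\<nu>)\<^sup>2"
  proof (rule nn_integral_Minkowski_weighted)
    show "sigma_finite_measure lborel" "sigma_finite_measure \<nu>" ..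
    show "c \<in> borel_measurable \<nu>"
      unfolding c_def by measurable
    show "case_prod (\<lambda>\<theta> t. indicator {0..2 * pi} \<theta> * ennreal (norm (k \<theta> t))) \<in> borel_measurable (lborel \<Otimes>\<^sub>M \<nu>)"
      unfolding k_def disc_aut_def by measurable
    fix t assume "t \<in> space \<nu>"
    then have t: "t \<in> {0..<1}" by (simp add: \<nu>)
    then show "c t > 0" using d by (auto simp: c_def intro!: mult_pos_pos divide_pos_pos)
    have "(\<integral>\<^sup>+\<theta>. (indicator {0..2 * pi} \<theta> * ennreal (norm (k \<theta> t)))\<^sup>2 \<partial>lborel)
        = (\<integral>\<^sup>+\<theta>\<in>{0..2 * pi}. ennreal ((norm (k \<theta> t))\<^sup>2) \<partial>lborel)"
      by (intro nn_integral_cong) (auto simp: indicator_def ennreal_power)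
    also have "\<dots> \<le> ennreal (16 * pi * d * (1 / (sqrt (1 - t) * (1 - t + d)))\<^sup>2)"
      unfolding k_def d_def by (rule kernel_circle_mean_le[OF a t r])
    also have "\<dots> = ennreal ((c t)\<^sup>2)"
      using d unfolding c_def power_mult_distrib by simp
    finally show "(\<integral>\<^sup>+\<theta>. (indicator {0..2 * pi} \<theta> * ennreal (norm (k \<theta> t)))\<^sup>2 \<partial>lborel) \<le> ennreal ((c t)\<^sup>2)" .
  qed
  also have "(\<integral>\<^sup>+t. ennreal (c t) \<partial>\<nu>) = ennreal (sqrt (16 * pi * d)) * (\<integral>\<^sup>+t. ennreal (1 / (sqrt (1 - t) * (1 - t + d))) \<partial>\<nu>)"
  proof -
    have "ennreal (c t) = ennreal (sqrt (16 * pi * d)) * ennreal (1 / (sqrt (1 - t) * (1 - t + d)))" for t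
      unfolding c_def using d by (intro ennreal_mult') simp
    then show ?thesis by (simp only:) (rule nn_integral_cmult, measurable)
  qed
  also have "\<dots> \<le> ennreal (sqrt (16 * pi * d)) * ennreal (K * (pi / sqrt d))"
    by (intro mult_left_mono carleson_kernel_integral_le[OF \<nu>(1) K(1) \<nu>K d]) auto
  also have "\<dots> = ennreal (4 * sqrt pi * pi * K)"
    using d K(1) by (subst ennreal_mult[symmetric]) (auto simp: real_sqrt_mult)
  finally have "ennreal J \<le> (ennreal (4 * sqrt pi * pi * K))\<^sup>2"
    by (simp add: power_mono)
  then have "J \<le> (4 * sqrt pi * pi * K)\<^sup>2"
    using K(1) by (simp add: ennreal_power)
  also have "\<dots> = 16 * pi ^ 3 * K\<^sup>2"
    by (simp add: power_mult_distrib power2_eq_square power3_eq_cube)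
  finally have "1 / (2 * pi) * J \<le> 8 * pi\<^sup>2 * K\<^sup>2"
    by (simp add: field_simps power2_eq_square power3_eq_cube)
  also have "\<dots> \<le> (3 * pi * K)\<^sup>2" by (simp add: power_mult_distrib mult_right_mono)
  finally have "sqrt (1 / (2 * pi) * J) \<le> 3 * pi * K"
    using K(1) by (intro real_le_lsqrt) auto
  then show ?thesis by (simp add: circle_mean2_def J_def G_def)
qed

text \<open>The circle means are bounded by \<open>3 \<pi> K\<close>, and the value at \<open>0\<close> by the total mass, which is at most \<open>K\<close>
  by the hypothesis at \<open>t = 0\<close>.\<close>

lemma bmoa_norm_I_op_le:
  fixes F :: "complex \<Rightarrow> complex"
  assumes \<mu>: "borel_measure_on_01 \<mu>" and F: "integrable \<mu> (\<lambda>t. F (of_real t))"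
    and K: "K \<ge> 0" "\<And>t. t \<in> {0..<1} \<Longrightarrow> (\<integral>\<^sup>+s\<in>{t..<1}. ennreal (norm (F (of_real s))) \<partial>\<mu>) \<le> ennreal (K * (1 - t))"
  shows "bmoa_norm (I_op \<mu> F) \<le> ennreal ((1 + 3 * pi) * K)"
proof -
  have "ennreal (norm (I_op \<mu> F 0)) \<le> (\<integral>\<^sup>+t. ennreal (norm (F (of_real t))) \<partial>\<mu>)"
    using integral_norm_bound_ennreal[OF F] by (simp add: I_op_def)
  also have "\<dots> = (\<integral>\<^sup>+t\<in>{0..<1}. ennreal (norm (F (of_real t))) \<partial>\<mu>)"
    by (intro nn_integral_cong) (auto simp: space_borel_measure_on_01[OF \<mu>])
  also have "\<dots> \<le> ennreal K" using K(2)[of 0] by simp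
  finally have "ennreal (norm (I_op \<mu> F 0)) \<le> ennreal K" .
  moreover have "(SUP a\<in>ball 0 1. hardy2_norm (\<lambda>z. I_op \<mu> F (disc_aut a z) - I_op \<mu> F a)) \<le> ennreal (3 * pi * K)"
    unfolding hardy2_norm_def
    by (intro SUP_least ennreal_leI circle_mean2_I_op_le[OF \<mu> F K]) auto
  ultimately have "bmoa_norm (I_op \<mu> F) \<le> ennreal K + ennreal (3 * pi * K)"
    unfolding bmoa_norm_def by (rule add_mono)
  also have "\<dots> = ennreal ((1 + 3 * pi) * K)"
    using K(1) by (simp add: ennreal_plus[symmetric] algebra_simps del: ennreal_plus)
  finally show ?thesis .
qed

section \<open>Balls of the Bloch space\<close>

text \<open>The value at \<open>0\<close> and the derivative are bounded separately, whereas the Bloch norm bounds their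
  sum: this form passes to locally uniform limits termwise, and differs from a norm ball only by a
  factor \<open>2\<close> in the radius.\<close>

definition bloch_ball :: "real \<Rightarrow> (complex \<Rightarrow> complex) set" where
  "bloch_ball B = {f \<in> disc_holomorphic. norm (f 0) \<le> B \<and>
     (\<forall>z\<in>ball 0 1. (1 - (norm z)\<^sup>2) * norm (deriv f z) \<le> B)}"

lemma bloch_ball_nonneg: "f \<in> bloch_ball B \<Longrightarrow> B \<ge> 0"
  unfolding bloch_ball_def using norm_ge_zero order_trans by blast

lemma bloch_norm_le_imp_bloch_ball:
  assumes "f \<in> disc_holomorphic" "bloch_norm f \<le> ennreal B" "B \<ge> 0"
  shows "f \<in> bloch_ball B"
proof -
  let ?S = "SUP z\<in>ball 0 1. ennreal ((1 - (norm z)\<^sup>2) * norm (deriv f z))"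
  have "ennreal (norm (f 0)) \<le> bloch_norm f" "?S \<le> bloch_norm f"
    unfolding bloch_norm_def by (auto intro: add_increasing add_increasing2)
  moreover have "ennreal ((1 - (norm z)\<^sup>2) * norm (deriv f z)) \<le> ?S" if "z \<in> ball 0 1" for z
    using that by (intro SUP_upper)
  ultimately have "ennreal (norm (f 0)) \<le> ennreal B"
    "\<And>z. z \<in> ball 0 1 \<Longrightarrow> ennreal ((1 - (norm z)\<^sup>2) * norm (deriv f z)) \<le> ennreal B"
    using assms(2) by (blast intro: order_trans)+
  then show ?thesis
    using assms by (simp add: bloch_ball_def)
qed

text \<open>The derivative of \<open>f \<circ> \<phi>\<^sub>a\<close> at \<open>0\<close> has modulus \<open>(1 - |a|\<^sup>2) |f'(a)|\<close> and is controlled by the mean of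
  \<open>f \<circ> \<phi>\<^sub>a - f(a)\<close> over any circle. The circle of radius \<open>1 / 2\<close> is used, whence the factor \<open>2\<close>.\<close>

lemma bmoa_norm_le_imp_bloch_ball:
  assumes f: "f \<in> disc_holomorphic" and le: "bmoa_norm f \<le> ennreal B" and B: "B \<ge> 0"
  shows "f \<in> bloch_ball (2 * B)"
proof -
  let ?S = "SUP a\<in>ball 0 1. hardy2_norm (\<lambda>z. f (disc_aut a z) - f a)"
  have hol: "f holomorphic_on ball 0 1" using f by (simp add: disc_holomorphic_def)
  have "ennreal (norm (f 0)) \<le> bmoa_norm f" "?S \<le> bmoa_norm f"
    unfolding bmoa_norm_def by (auto intro: add_increasing add_increasing2)
  with le have le: "ennreal (norm (f 0)) \<le> ennreal B" "?S \<le> ennreal B"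
    by (blast intro: order_trans)+
  have "(1 - (norm a)\<^sup>2) * norm (deriv f a) \<le> 2 * B" if a: "a \<in> ball 0 1" for a
  proof -
    let ?g = "\<lambda>z. f (disc_aut a z) - f a"
    have na: "of_real ((norm a)\<^sup>2) = a * cnj a" by (rule complex_norm_square)
    have "(disc_aut a has_field_derivative - of_real (1 - (norm a)\<^sup>2)) (at 0)"
      unfolding disc_aut_def of_real_diff na by (auto intro!: derivative_eq_intros)
    moreover have "(f has_field_derivative deriv f a) (at (disc_aut a 0))"
      using holomorphic_derivI[OF hol _ a] by (simp add: disc_aut_def)
    ultimately have "((\<lambda>z. f (disc_aut a z)) has_field_derivative deriv f a * (- of_real (1 - (norm a)\<^sup>2))) (at 0)"
      by (rule DERIV_chain2[rotated])
    then have "(?g has_field_derivative deriv f a * (- of_real (1 - (norm a)\<^sup>2))) (at 0)"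
      by (auto intro!: derivative_eq_intros)
    then have "norm (deriv ?g 0) = norm (deriv f a) * norm (of_real (1 - (norm a)\<^sup>2) :: complex)"
      by (simp add: DERIV_imp_deriv norm_mult del: of_real_diff)
    also have "norm (of_real (1 - (norm a)\<^sup>2) :: complex) = 1 - (norm a)\<^sup>2"
      unfolding norm_of_real using a by (simp add: abs_square_le_1 less_imp_le)
    finally have "(1 - (norm a)\<^sup>2) * norm (deriv f a) = norm (deriv ?g 0)" by simp
    also have "\<dots> \<le> circle_mean2 (1 / 2) ?g / (1 / 2)"
      by (rule norm_deriv_0_le_circle_mean2[OF holomorphic_disc_aut[OF hol a]]) auto
    finally have "(1 - (norm a)\<^sup>2) * norm (deriv f a) \<le> 2 * circle_mean2 (1 / 2) ?g" by simp
    moreover have "ennreal (circle_mean2 (1 / 2) ?g) \<le> hardy2_norm ?g"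
      unfolding hardy2_norm_def by (rule SUP_upper) auto
    moreover have "hardy2_norm ?g \<le> ?S" using a by (rule SUP_upper)
    ultimately show ?thesis
      using le(2) B by (meson ennreal_le_iff mult_left_mono order_trans zero_le_numeral)
  qed
  then show ?thesis using f le(1) B by (auto simp: bloch_ball_def)
qed

text \<open>Integrate \<open>|f'(s z)| |z| \<le> B |z| / (1 - s |z|)\<close> along the radius from \<open>0\<close> to \<open>z\<close>.\<close>

lemma bloch_ball_growth:
  assumes f: "f \<in> bloch_ball B" and z: "norm z < 1"
  shows "norm (f z) \<le> B * (1 + ln (1 / (1 - norm z)))"
proof -
  have hol: "f holomorphic_on ball 0 1" and f0: "norm (f 0) \<le> B"
    and f': "\<And>w. norm w < 1 \<Longrightarrow> (1 - (norm w)\<^sup>2) * norm (deriv f w) \<le> B"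
    using f by (auto simp: bloch_ball_def disc_holomorphic_def)
  have B: "B \<ge> 0" by (rule bloch_ball_nonneg[OF f])
  have sz: "s * norm z < 1" "norm (of_real s * z) = s * norm z" if "s \<in> {0..1}" for s :: real
  proof -
    have "s * norm z \<le> norm z" using that by (intro mult_left_le_one_le) auto
    then show "s * norm z < 1" using z by simp
    show "norm (of_real s * z) = s * norm z" using that by (simp add: norm_mult)
  qed
  have der: "((\<lambda>s. f (of_real s * z)) has_vector_derivative z * deriv f (of_real s * z)) (at s)" if "s \<in> {0..1}" for s :: real
  proof -
    have "(f has_field_derivative deriv f (of_real s * z)) (at (of_real s * z))"
      using sz[OF that] by (intro holomorphic_derivI[OF hol]) auto
    moreover have "((\<lambda>s. of_real s * z) has_vector_derivative z) (at s)"
      by (auto intro!: derivative_eq_intros)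
    ultimately show ?thesis
      by (rule field_vector_diff_chain_at[unfolded o_def, rotated])
  qed
  have "norm (f (of_real 1 * z) - f (of_real 0 * z)) \<le> - B * ln (1 - 1 * norm z) - (- B * ln (1 - 0 * norm z))"
  proof (rule differentiable_bound_general[where f' = "\<lambda>s. z * deriv f (of_real s * z)"
        and \<phi>' = "\<lambda>s. B * (norm z / (1 - s * norm z))"])
    show "continuous_on {0..1} (\<lambda>s. f (of_real s * z))"
      using der by (meson continuous_at_imp_continuous_on has_vector_derivative_continuous)
    show "continuous_on {0..1} (\<lambda>s. - B * ln (1 - s * norm z))"
      using sz(1) by (intro continuous_intros) fastforce
    fix s :: real assume "0 < s" "s < 1"
    then have s: "s \<in> {0..1}" by auto
    show "((\<lambda>s. f (of_real s * z)) has_vector_derivative z * deriv f (of_real s * z)) (at s)"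
      by (rule der[OF s])
    show "((\<lambda>s. - B * ln (1 - s * norm z)) has_vector_derivative B * (norm z / (1 - s * norm z))) (at s)"
      unfolding has_real_derivative_iff_has_vector_derivative[symmetric]
      using sz(1)[OF s] by (auto intro!: derivative_eq_intros)
    define x where "x = s * norm z"
    have x: "0 \<le> x" "x < 1" using sz(1)[OF s] s by (auto simp: x_def)
    define D where "D = norm (deriv f (of_real s * z))"
    have "(1 - x) * D \<le> (1 - x\<^sup>2) * D"
      using x by (intro mult_right_mono) (auto simp: D_def power2_eq_square mult_left_le)
    also have "\<dots> \<le> B" using f'[of "of_real s * z"] sz[OF s] by (simp add: x_def D_def)
    finally have "norm z * D \<le> norm z * (B / (1 - x))"
      using x by (intro mult_left_mono) (auto simp: field_simps)
    then show "norm (z * deriv f (of_real s * z)) \<le> B * (norm z / (1 - s * norm z))"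
      by (simp add: norm_mult D_def x_def mult.commute)
  qed simp
  then have "norm (f z - f 0) \<le> - B * ln (1 - norm z)" by simp
  moreover have "ln (1 / (1 - norm z)) = - ln (1 - norm z)" using z by (simp add: ln_div)
  ultimately show ?thesis
    using norm_triangle_sub[of "f z" "f 0"] f0 by (simp add: algebra_simps)
qed

text \<open>This is the form in which \<open>f d\<mu>\<close> is dominated by the measure of the hypothesis; the factor \<open>2\<close>
  absorbs the constant term because \<open>ln 2 \<ge> 1 / 2\<close>.\<close>

lemma bloch_ball_growth_real:
  assumes f: "f \<in> bloch_ball B" and t: "t \<in> {0..<1}"
  shows "norm (f (of_real t)) \<le> 2 * B * ln (2 / (1 - t))"
proof -
  have B: "B \<ge> 0" by (rule bloch_ball_nonneg[OF f])
  have "ln (exp 1) \<le> ln (4 :: real)"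
    using exp_le by (intro ln_mono) auto
  also have "ln (4 :: real) = 2 * ln 2" using ln_realpow[of 2 2] by simp
  finally have ln2: "1 \<le> 2 * ln (2 :: real)" by simp
  have "ln (1 / (1 - t)) \<ge> 0" using t by (intro ln_ge_zero) auto
  moreover have "ln (2 / (1 - t)) = ln 2 + ln (1 / (1 - t))" using t by (simp add: ln_div)
  ultimately have "1 + ln (1 / (1 - t)) \<le> 2 * ln (2 / (1 - t))" using ln2 by linarith
  then have "B * (1 + ln (1 / (1 - t))) \<le> B * (2 * ln (2 / (1 - t)))" using B by (intro mult_left_mono)
  then show ?thesis using bloch_ball_growth[OF f, of "of_real t"] t by simp
qed

lemma bloch_ball_diff:
  assumes f: "f \<in> bloch_ball B" and g: "g \<in> bloch_ball C"
  shows "(\<lambda>z. f z - g z) \<in> bloch_ball (B + C)"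
proof -
  have hol: "f holomorphic_on ball 0 1" "g holomorphic_on ball 0 1"
    using f g by (auto simp: bloch_ball_def disc_holomorphic_def)
  have "(1 - (norm z)\<^sup>2) * norm (deriv (\<lambda>z. f z - g z) z) \<le> B + C" if z: "z \<in> ball 0 1" for z
  proof -
    have "deriv (\<lambda>z. f z - g z) z = deriv f z - deriv g z"
      using hol z by (intro deriv_diff) (auto simp: holomorphic_on_imp_differentiable_at)
    then have "(1 - (norm z)\<^sup>2) * norm (deriv (\<lambda>z. f z - g z) z)
        \<le> (1 - (norm z)\<^sup>2) * (norm (deriv f z) + norm (deriv g z))"
      using z by (intro mult_left_mono) (auto simp: norm_triangle_ineq4 abs_square_le_1 less_imp_le)
    also have "\<dots> \<le> B + C"
      using f g z by (auto simp: bloch_ball_def distrib_left intro: add_mono)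
    finally show ?thesis .
  qed
  moreover have "norm (f 0 - g 0) \<le> B + C"
    using f g norm_triangle_ineq4[of "f 0" "g 0"] by (auto simp: bloch_ball_def)
  ultimately show ?thesis
    using f g hol by (auto simp: bloch_ball_def disc_holomorphic_def intro!: holomorphic_intros)
qed

text \<open>The growth estimate makes a Bloch ball locally bounded, so Montel's theorem applies; the ball is
  closed under locally uniform limits because derivatives converge as well.\<close>

lemma bloch_ball_Montel:
  assumes f: "\<And>n :: nat. f n \<in> bloch_ball B"
  obtains g r where "g \<in> bloch_ball B" "strict_mono (r :: nat \<Rightarrow> nat)"
    "\<And>R. R < 1 \<Longrightarrow> uniform_limit (cball 0 R) (\<lambda>n. f (r n)) g sequentially"
proof -
  have hol: "h holomorphic_on ball 0 1" if "h \<in> bloch_ball B" for h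
    using that by (auto simp: bloch_ball_def disc_holomorphic_def)
  have bound: "\<exists>b. \<forall>h\<in>bloch_ball B. \<forall>z\<in>K. norm (h z) \<le> b" if K: "compact K" "K \<subseteq> ball 0 1" for K :: "complex set"
  proof (cases "K = {}")
    case False
    obtain m where m: "m \<in> K" "\<And>z. z \<in> K \<Longrightarrow> norm z \<le> norm m"
      using continuous_attains_sup[OF K(1) False, of norm] by (auto intro: continuous_intros)
    have m1: "norm m < 1" using m(1) K(2) by auto
    have "norm (h z) \<le> B * (1 + ln (1 / (1 - norm m)))" if h: "h \<in> bloch_ball B" and z: "z \<in> K" for h z
    proof -
      have B: "B \<ge> 0" by (rule bloch_ball_nonneg[OF h])
      have nz: "norm z \<le> norm m" by (rule m(2)[OF z])
      have "norm (h z) \<le> B * (1 + ln (1 / (1 - norm z)))"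
        using nz m1 by (intro bloch_ball_growth[OF h]) auto
      also have "\<dots> \<le> B * (1 + ln (1 / (1 - norm m)))"
        using nz m1 B by (intro mult_left_mono add_left_mono ln_mono divide_left_mono mult_pos_pos) auto
      finally show ?thesis .
    qed
    then show ?thesis by blast
  qed auto
  obtain g r where g: "g holomorphic_on ball 0 1" and r: "strict_mono (r :: nat \<Rightarrow> nat)"
    and unif: "\<And>K. compact K \<Longrightarrow> K \<subseteq> ball 0 1 \<Longrightarrow> uniform_limit K (f \<circ> r) g sequentially"
    using Montel[of "ball 0 1" "bloch_ball B" f] hol bound f by (metis image_subsetI open_ball)
  \<comment> \<open>Elements of \<open>disc_holomorphic\<close> vanish off the disc, so the limit is extended by \<open>0\<close>.\<close>
  define h where "h z = (if z \<in> ball 0 1 then g z else 0)" for z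
  have hhol: "h \<in> disc_holomorphic"
    using holomorphic_transform[OF g, of h] by (auto simp: disc_holomorphic_def h_def)
  have lim: "uniform_limit (cball 0 R) (\<lambda>n. f (r n)) h sequentially" if "R < 1" for R
  proof -
    have "uniform_limit (cball 0 R) (f \<circ> r) g sequentially"
      using that by (intro unif) auto
    moreover have "uniform_limit (cball 0 R) (f \<circ> r) g sequentially
        \<longleftrightarrow> uniform_limit (cball 0 R) (\<lambda>n. f (r n)) h sequentially"
      using that by (intro uniform_limit_cong') (auto simp: h_def)
    ultimately show ?thesis by blast
  qed
  have "norm (h 0) \<le> B"
  proof (rule Lim_bounded)
    show "(\<lambda>n. norm (f (r n) 0)) \<longlonglongrightarrow> norm (h 0)"
      using tendsto_uniform_limitI[OF lim[of 0], of 0] by (intro tendsto_norm) auto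
    show "\<forall>n\<ge>0. norm (f (r n) 0) \<le> B" using f by (auto simp: bloch_ball_def)
  qed
  moreover have "(1 - (norm z)\<^sup>2) * norm (deriv h z) \<le> B" if z: "z \<in> ball 0 1" for z
  proof (rule Lim_bounded)
    define R where "R = (1 + norm z) / 2"
    have R: "norm z < R" "R < 1" using z by (auto simp: R_def)
    have "(\<lambda>n. deriv (f (r n)) z) \<longlonglongrightarrow> deriv h z"
    proof (rule deriv_complex_uniform_limit)
      show "uniform_limit (ball 0 R) (\<lambda>n. f (r n)) h sequentially"
        by (rule uniform_limit_on_subset[OF lim[OF R(2)]]) auto
      show "\<forall>\<^sub>F n in sequentially. f (r n) holomorphic_on ball 0 R"
        using R by (intro always_eventually allI holomorphic_on_subset[OF hol[OF f]]) auto
    qed (use R in auto)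
    then show "(\<lambda>n. (1 - (norm z)\<^sup>2) * norm (deriv (f (r n)) z)) \<longlonglongrightarrow> (1 - (norm z)\<^sup>2) * norm (deriv h z)"
      by (intro tendsto_intros)
    show "\<forall>n\<ge>0. (1 - (norm z)\<^sup>2) * norm (deriv (f (r n)) z) \<le> B" using f z by (auto simp: bloch_ball_def)
  qed
  ultimately have "h \<in> bloch_ball B" using hhol by (simp add: bloch_ball_def)
  then show thesis using r lim by (rule that)
qed

section \<open>Compactness\<close>

locale log_vanishing_carleson =
  fixes \<mu> :: "real measure"
  assumes borel01: "borel_measure_on_01 \<mu>"
    and log_integral: "(\<integral>\<^sup>+t. ennreal (ln (2 / (1 - t))) \<partial>\<mu>) < \<infinity>"
    and vanishing: "vanishing_carleson_measure (density \<mu> (\<lambda>t. ennreal (ln (2 / (1 - t)))))"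
begin

lemma space_\<mu>: "space \<mu> = {0..<1}"
  by (rule space_borel_measure_on_01[OF borel01])

lemma measurable_id_\<mu>[measurable]: "(\<lambda>t. t) \<in> borel_measurable \<mu>"
  by (rule measurable_ident_borel_measure_on_01[OF borel01])

lemma ln_two_le_log: "t \<in> {0..<1} \<Longrightarrow> ln 2 \<le> ln (2 / (1 - t))" for t :: real
  by (intro ln_mono) (auto simp: field_simps)

text \<open>The logarithmic weight is bounded below by \<open>ln 2 > 0\<close>.\<close>

lemma finite_measure_\<mu>: "finite_measure \<mu>"
proof (rule finite_measureI)
  have "ennreal (ln 2) * emeasure \<mu> (space \<mu>) = (\<integral>\<^sup>+t. ennreal (ln 2) \<partial>\<mu>)"
    by simp
  also have "\<dots> \<le> (\<integral>\<^sup>+t. ennreal (ln (2 / (1 - t))) \<partial>\<mu>)"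
    by (intro nn_integral_mono ennreal_leI ln_two_le_log) (simp add: space_\<mu>)
  also have "\<dots> < \<infinity>" by (rule log_integral)
  finally show "emeasure \<mu> (space \<mu>) \<noteq> \<infinity>"
    by (auto simp: ennreal_mult_top)
qed

lemma log_tail_eq_emeasure:
  assumes "t \<in> {0..<1}"
  shows "(\<integral>\<^sup>+s\<in>{t..<1}. ennreal (ln (2 / (1 - s))) \<partial>\<mu>)
    = emeasure (density \<mu> (\<lambda>t. ennreal (ln (2 / (1 - t))))) {t..<1}"
  using assms borel01
  by (subst emeasure_density) (auto simp: borel_measure_on_01_def sets_restrict_space_iff)

lemma log_tail_eventually_small:
  assumes e: "e > 0"
  obtains R where "R \<in> {0..<1}"
    "\<And>t. t \<in> {R..<1} \<Longrightarrow> (\<integral>\<^sup>+s\<in>{t..<1}. ennreal (ln (2 / (1 - s))) \<partial>\<mu>) \<le> ennreal (e * (1 - t))"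
proof -
  let ?\<nu> = "density \<mu> (\<lambda>t. ennreal (ln (2 / (1 - t))))"
  have "((\<lambda>t. emeasure ?\<nu> {t..<1} / ennreal (1 - t)) \<longlongrightarrow> 0) (at_left 1)"
    using vanishing by (simp add: vanishing_carleson_measure_def)
  then have "\<forall>\<^sub>F t in at_left 1. emeasure ?\<nu> {t..<1} / ennreal (1 - t) < ennreal e"
    by (rule order_tendstoD) (use e in simp)
  then obtain b where b: "b < 1" "\<And>t. b < t \<Longrightarrow> t < 1 \<Longrightarrow> emeasure ?\<nu> {t..<1} / ennreal (1 - t) < ennreal e"
    unfolding eventually_at_left[OF zero_less_one] by blast
  show thesis
  proof (rule that)
    show R: "max 0 ((b + 1) / 2) \<in> {0..<1}" using b(1) by auto
    fix t assume "t \<in> {max 0 ((b + 1) / 2)..<1}"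
    then have t: "t \<in> {0..<1}" "b < t" using b(1) by auto
    have "(\<integral>\<^sup>+s\<in>{t..<1}. ennreal (ln (2 / (1 - s))) \<partial>\<mu>) = emeasure ?\<nu> {t..<1}"
      by (rule log_tail_eq_emeasure[OF t(1)])
    also have "\<dots> = emeasure ?\<nu> {t..<1} / ennreal (1 - t) * ennreal (1 - t)"
      using t by (simp add: ennreal_divide_times ennreal_divide_self)
    also have "\<dots> \<le> ennreal e * ennreal (1 - t)"
      using b(2)[of t] t by (intro mult_right_mono) auto
    also have "\<dots> = ennreal (e * (1 - t))"
      using e by (simp add: ennreal_mult')
    finally show "(\<integral>\<^sup>+s\<in>{t..<1}. ennreal (ln (2 / (1 - s))) \<partial>\<mu>) \<le> ennreal (e * (1 - t))" .
  qed
qed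

lemma bloch_ball_integrable:
  assumes f: "f \<in> bloch_ball B"
  shows "integrable \<mu> (\<lambda>t. f (of_real t))"
proof (rule integrableI_bounded)
  have "continuous_on (ball 0 1) f"
    using f by (auto simp: bloch_ball_def disc_holomorphic_def holomorphic_on_imp_continuous_on)
  then have "continuous_on {0..<1} (\<lambda>t. f (of_real t))"
    by (rule continuous_on_compose2) (auto intro!: continuous_intros)
  then show "(\<lambda>t. f (of_real t)) \<in> borel_measurable \<mu>"
    by (rule continuous_measurable_borel_measure_on_01[OF borel01])
  have B: "B \<ge> 0" by (rule bloch_ball_nonneg[OF f])
  have "(\<integral>\<^sup>+t. ennreal (norm (f (of_real t))) \<partial>\<mu>) \<le> (\<integral>\<^sup>+t. ennreal (2 * B) * ennreal (ln (2 / (1 - t))) \<partial>\<mu>)"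
    using bloch_ball_growth_real[OF f] B
    by (intro nn_integral_mono) (simp add: space_\<mu> ennreal_mult'[symmetric] ennreal_leI)
  also have "\<dots> = ennreal (2 * B) * (\<integral>\<^sup>+t. ennreal (ln (2 / (1 - t))) \<partial>\<mu>)"
    by (rule nn_integral_cmult) measurable
  also have "\<dots> < \<infinity>" using log_integral by (simp add: ennreal_mult_less_top)
  finally show "(\<integral>\<^sup>+t. ennreal (norm (f (of_real t))) \<partial>\<mu>) < \<infinity>" .
qed

text \<open>For \<open>t \<ge> R\<close> only the growth of \<open>f\<close> and the tail of the weighted measure count. For \<open>t < R\<close> the mass on
  \<open>[t, R)\<close> is at most \<open>\<eta> \<mu>([0, 1))\<close>, hence at most \<open>\<eta> \<mu>([0, 1)) (1 - t) / (1 - R)\<close>; and the mass on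
  \<open>[R, 1)\<close> is at most \<open>2 B e (1 - R) \<le> 2 B e (1 - t)\<close>.\<close>

lemma bloch_ball_tail_le:
  assumes f: "f \<in> bloch_ball B" and R: "R \<in> {0..<1}"
    and tail: "\<And>t. t \<in> {R..<1} \<Longrightarrow> (\<integral>\<^sup>+s\<in>{t..<1}. ennreal (ln (2 / (1 - s))) \<partial>\<mu>) \<le> ennreal (e * (1 - t))"
    and e: "e \<ge> 0" and \<eta>: "\<eta> \<ge> 0" and small: "\<And>t. t \<in> {0..R} \<Longrightarrow> norm (f (of_real t)) \<le> \<eta>"
    and t: "t \<in> {0..<1}"
  shows "(\<integral>\<^sup>+s\<in>{t..<1}. ennreal (norm (f (of_real s))) \<partial>\<mu>)
    \<le> ennreal ((2 * B * e + \<eta> * measure \<mu> (space \<mu>) / (1 - R)) * (1 - t))"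
proof -
  interpret finite_measure \<mu> by (rule finite_measure_\<mu>)
  define m where "m = measure \<mu> (space \<mu>)"
  have B: "B \<ge> 0" by (rule bloch_ball_nonneg[OF f])
  define T where "T = max t R"
  have T: "T \<in> {R..<1}" using t R by (auto simp: T_def)
  let ?L = "\<lambda>s. ennreal (ln (2 / (1 - s)))"
  let ?c = "if t < R then ennreal \<eta> else 0"
  have "(\<integral>\<^sup>+s\<in>{t..<1}. ennreal (norm (f (of_real s))) \<partial>\<mu>)
      \<le> (\<integral>\<^sup>+s. ?c + ennreal (2 * B) * (?L s * indicator {T..<1} s) \<partial>\<mu>)"
  proof (rule nn_integral_mono)
    fix s assume "s \<in> space \<mu>"
    then have s: "s \<in> {0..<1}" by (simp add: space_\<mu>)
    have L: "ennreal (norm (f (of_real s))) \<le> ennreal (2 * B) * ?L s"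
      using bloch_ball_growth_real[OF f s] B by (simp add: ennreal_mult'[symmetric] ennreal_leI)
    have "ennreal (norm (f (of_real s))) \<le> ennreal \<eta>" if "s < R"
      using small[of s] s that by (simp add: ennreal_leI)
    with L s t show "ennreal (norm (f (of_real s))) * indicator {t..<1} s
        \<le> ?c + ennreal (2 * B) * (?L s * indicator {T..<1} s)"
      by (auto simp: indicator_def T_def intro: add_increasing)
  qed
  also have "\<dots> = (\<integral>\<^sup>+s. ?c \<partial>\<mu>) + ennreal (2 * B) * (\<integral>\<^sup>+s\<in>{T..<1}. ?L s \<partial>\<mu>)"
    by (subst nn_integral_add) (auto intro!: nn_integral_cmult)
  also have "\<dots> \<le> ennreal (\<eta> * m / (1 - R) * (1 - t)) + ennreal (2 * B) * ennreal (e * (1 - T))"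
  proof (intro add_mono mult_left_mono tail T)
    have "\<eta> * m \<le> \<eta> * m / (1 - R) * (1 - t)" if "t < R"
    proof -
      have "1 \<le> (1 - t) / (1 - R)" using that R by simp
      then have "\<eta> * m * 1 \<le> \<eta> * m * ((1 - t) / (1 - R))"
        using \<eta> by (intro mult_left_mono) (auto simp: m_def)
      then show ?thesis by simp
    qed
    moreover have "(\<integral>\<^sup>+s. ?c \<partial>\<mu>) = (if t < R then ennreal (\<eta> * m) else 0)"
      using \<eta> by (simp add: emeasure_eq_measure m_def ennreal_mult)
    ultimately show "(\<integral>\<^sup>+s. ?c \<partial>\<mu>) \<le> ennreal (\<eta> * m / (1 - R) * (1 - t))"
      by (auto intro: ennreal_leI)
  qed auto
  also have "\<dots> \<le> ennreal (\<eta> * m / (1 - R) * (1 - t)) + ennreal (2 * B * e * (1 - t))"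
  proof (rule add_left_mono)
    have "2 * B * (e * (1 - T)) \<le> 2 * B * (e * (1 - t))"
      using B e by (intro mult_left_mono) (auto simp: T_def)
    then show "ennreal (2 * B) * ennreal (e * (1 - T)) \<le> ennreal (2 * B * e * (1 - t))"
      using B by (simp add: ennreal_mult'[symmetric] ennreal_leI mult.assoc)
  qed
  also have "\<dots> = ennreal ((2 * B * e + \<eta> * m / (1 - R)) * (1 - t))"
  proof -
    have "0 \<le> \<eta> * m / (1 - R) * (1 - t)" "0 \<le> 2 * B * e * (1 - t)"
      using \<eta> R t B e by (auto simp: m_def)
    then show ?thesis
      by (simp only: ennreal_plus[symmetric] distrib_right add.commute)
  qed
  finally show ?thesis by (simp add: m_def)
qed


lemma bmoa_norm_I_op_le_of_tail:
  assumes f: "f \<in> bloch_ball B" and R: "R \<in> {0..<1}"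
    and tail: "\<And>t. t \<in> {R..<1} \<Longrightarrow> (\<integral>\<^sup>+s\<in>{t..<1}. ennreal (ln (2 / (1 - s))) \<partial>\<mu>) \<le> ennreal (e * (1 - t))"
    and e: "e \<ge> 0" and \<eta>: "\<eta> \<ge> 0" and small: "\<And>t. t \<in> {0..R} \<Longrightarrow> norm (f (of_real t)) \<le> \<eta>"
  shows "bmoa_norm (I_op \<mu> f) \<le> ennreal ((1 + 3 * pi) * (2 * B * e + \<eta> * measure \<mu> (space \<mu>) / (1 - R)))"
proof (rule bmoa_norm_I_op_le[OF borel01 bloch_ball_integrable[OF f]])
  have B: "B \<ge> 0" by (rule bloch_ball_nonneg[OF f])
  show "2 * B * e + \<eta> * measure \<mu> (space \<mu>) / (1 - R) \<ge> 0"
    using B e \<eta> R by auto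
qed (rule bloch_ball_tail_le[OF f R tail e \<eta> small])

text \<open>The preceding estimate with \<open>R = 0\<close> and the Carleson constant itself in place of \<open>e\<close>.\<close>

lemma I_op_in_bmoa:
  assumes f: "f \<in> bloch_ball B"
  shows "I_op \<mu> f \<in> bmoa"
proof -
  obtain C where C: "C > 0" "\<And>t. t \<in> {0..<1} \<Longrightarrow>
      emeasure (density \<mu> (\<lambda>t. ennreal (ln (2 / (1 - t))))) {t..<1} \<le> ennreal (C * (1 - t))"
    using vanishing by (auto simp: vanishing_carleson_measure_def carleson_measure_def)
  have f0: "norm (f 0) \<le> B" using f by (simp add: bloch_ball_def)
  have B: "B \<ge> 0" by (rule bloch_ball_nonneg[OF f])
  have "bmoa_norm (I_op \<mu> f) \<le> ennreal ((1 + 3 * pi) * (2 * B * C + B * measure \<mu> (space \<mu>) / (1 - 0)))"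
    using C B f0 by (intro bmoa_norm_I_op_le_of_tail f) (auto simp: log_tail_eq_emeasure)
  also have "\<dots> < \<infinity>" by simp
  finally show ?thesis
    using I_op_disc_holomorphic[OF borel01 bloch_ball_integrable[OF f]] by (simp add: bmoa_def)
qed

text \<open>The sequential criterion for compactness on the Bloch space: bounded sequences converging to \<open>0\<close>
  locally uniformly are mapped to null sequences. Half of \<open>\<epsilon>\<close> pays for the tail near \<open>1\<close>, which fixes
  \<open>R\<close>, and half for the uniform smallness on \<open>[0, R]\<close>.\<close>

lemma bmoa_norm_I_op_eventually_le:
  assumes g: "\<And>n :: nat. g n \<in> bloch_ball B"
    and lim: "\<And>R. R < 1 \<Longrightarrow> uniform_limit (cball 0 R) g (\<lambda>_. 0) sequentially"
    and \<epsilon>: "\<epsilon> > 0"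
  shows "\<forall>\<^sub>F n in sequentially. bmoa_norm (I_op \<mu> (g n)) \<le> ennreal \<epsilon>"
proof -
  define m where "m = measure \<mu> (space \<mu>)"
  have m: "m \<ge> 0" by (simp add: m_def)
  have B: "B \<ge> 0" by (rule bloch_ball_nonneg[OF g[of 0]])
  define \<delta> where "\<delta> = \<epsilon> / (1 + 3 * pi) / 2"
  have "1 + 3 * pi > 0" using pi_gt_zero by linarith
  moreover have "c * (2 * (\<epsilon> / c / 2)) = \<epsilon>" if "c > 0" for c
    using that by simp
  ultimately have \<delta>: "\<delta> > 0" "(1 + 3 * pi) * (2 * \<delta>) = \<epsilon>"
    using \<epsilon> unfolding \<delta>_def by (blast intro: divide_pos_pos zero_less_numeral)+
  define e where "e = \<delta> / (2 * B + 1)"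
  have e: "e > 0" "2 * B * e \<le> \<delta>"
    using \<delta> B by (auto simp: e_def field_simps)
  obtain R where R: "R \<in> {0..<1}"
    and tail: "\<And>t. t \<in> {R..<1} \<Longrightarrow> (\<integral>\<^sup>+s\<in>{t..<1}. ennreal (ln (2 / (1 - s))) \<partial>\<mu>) \<le> ennreal (e * (1 - t))"
    using log_tail_eventually_small[OF e(1)] by blast
  define \<eta> where "\<eta> = \<delta> * (1 - R) / (m + 1)"
  have \<eta>: "\<eta> > 0" using \<delta> R m by (auto simp: \<eta>_def intro!: mult_pos_pos divide_pos_pos)
  have "\<eta> * m / (1 - R) = \<delta> * (m / (m + 1))" using R by (simp add: \<eta>_def)
  also have "\<dots> \<le> \<delta>" using \<delta>(1) m by (intro mult_right_le_one_le) auto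
  finally have \<eta>m: "\<eta> * m / (1 - R) \<le> \<delta>" .
  have "\<forall>\<^sub>F n in sequentially. \<forall>z\<in>cball 0 R. dist (g n z) 0 < \<eta>"
    using lim[of R] R \<eta> by (intro uniform_limitD) auto
  then show ?thesis
  proof eventually_elim
    case (elim n)
    have "norm (g n (of_real t)) \<le> \<eta>" if "t \<in> {0..R}" for t
    proof -
      have "of_real t \<in> cball (0::complex) R" using that by simp
      with elim show ?thesis by fastforce
    qed
    then have "bmoa_norm (I_op \<mu> (g n)) \<le> ennreal ((1 + 3 * pi) * (2 * B * e + \<eta> * measure \<mu> (space \<mu>) / (1 - R)))"
      using tail e(1) \<eta> by (intro bmoa_norm_I_op_le_of_tail g R) auto
    also have "\<dots> \<le> ennreal ((1 + 3 * pi) * (2 * \<delta>))"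
      using e(2) \<eta>m by (intro ennreal_leI mult_left_mono) (auto simp: m_def)
    finally show ?case by (simp only: \<delta>(2))
  qed
qed

lemma I_op_add:
  assumes "f \<in> bloch_ball B" "g \<in> bloch_ball C"
  shows "I_op \<mu> (\<lambda>z. f z + g z) = (\<lambda>z. I_op \<mu> f z + I_op \<mu> g z)"
  using integrable_I_op[OF borel01 bloch_ball_integrable[OF assms(1)]]
    integrable_I_op[OF borel01 bloch_ball_integrable[OF assms(2)]]
  by (auto simp: I_op_def fun_eq_iff add_divide_distrib)

lemma I_op_diff:
  assumes "f \<in> bloch_ball B" "g \<in> bloch_ball C"
  shows "I_op \<mu> (\<lambda>z. f z - g z) = (\<lambda>z. I_op \<mu> f z - I_op \<mu> g z)"
  using integrable_I_op[OF borel01 bloch_ball_integrable[OF assms(1)]]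
    integrable_I_op[OF borel01 bloch_ball_integrable[OF assms(2)]]
  by (auto simp: I_op_def fun_eq_iff diff_divide_distrib)

lemma I_op_cmult: "I_op \<mu> (\<lambda>z. c * f z) = (\<lambda>z. c * I_op \<mu> f z)"
  by (auto simp: I_op_def fun_eq_iff simp flip: times_divide_eq_right)

sublocale Metric_space bmoa "norm_dist bmoa_norm"
  by (rule Metric_space_bmoa)

text \<open>The limit of a subsequence is \<open>I_op \<mu> g\<close> for the locally uniform limit \<open>g\<close>, which lies in the ball
  again.\<close>

lemma compactin_I_op_bloch_ball: "compactin mtopology (I_op \<mu> ` bloch_ball B)"
  unfolding compactin_sequentially
proof (intro conjI allI impI)
  show "I_op \<mu> ` bloch_ball B \<subseteq> bmoa" using I_op_in_bmoa by blast
  fix \<sigma> :: "nat \<Rightarrow> complex \<Rightarrow> complex" assume "range \<sigma> \<subseteq> I_op \<mu> ` bloch_ball B"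
  then have "\<forall>n. \<exists>h. h \<in> bloch_ball B \<and> \<sigma> n = I_op \<mu> h" by blast
  then obtain f where f: "\<And>n. f n \<in> bloch_ball B" and \<sigma>: "\<And>n. \<sigma> n = I_op \<mu> (f n)"
    by metis
  obtain g r where g: "g \<in> bloch_ball B" and r: "strict_mono (r :: nat \<Rightarrow> nat)"
    and lim: "\<And>R. R < 1 \<Longrightarrow> uniform_limit (cball 0 R) (\<lambda>n. f (r n)) g sequentially"
    using bloch_ball_Montel[of f B] f by metis
  have diff: "(\<lambda>z. f (r n) z - g z) \<in> bloch_ball (B + B)" for n
    by (rule bloch_ball_diff[OF f g])
  have lim0: "uniform_limit (cball 0 R) (\<lambda>n z. f (r n) z - g z) (\<lambda>_. 0) sequentially" if "R < 1" for R
    using lim[OF that] by (simp add: uniform_limit_iff dist_norm)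
  have "limitin mtopology (\<sigma> \<circ> r) (I_op \<mu> g) sequentially"
    unfolding limitin_metric
  proof (intro conjI allI impI)
    show "I_op \<mu> g \<in> bmoa" by (rule I_op_in_bmoa[OF g])
    fix \<epsilon> :: real assume \<epsilon>: "\<epsilon> > 0"
    have "\<forall>\<^sub>F n in sequentially. bmoa_norm (I_op \<mu> (\<lambda>z. f (r n) z - g z)) \<le> ennreal (\<epsilon> / 2)"
      using \<epsilon> by (intro bmoa_norm_I_op_eventually_le[OF diff lim0]) auto
    then show "\<forall>\<^sub>F n in sequentially. (\<sigma> \<circ> r) n \<in> bmoa \<and> norm_dist bmoa_norm ((\<sigma> \<circ> r) n) (I_op \<mu> g) < \<epsilon>"
    proof eventually_elim
      case (elim n)
      then have "enn2real (bmoa_norm (I_op \<mu> (\<lambda>z. f (r n) z - g z))) \<le> \<epsilon> / 2"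
        using \<epsilon> by (intro enn2real_leI) auto
      then show ?case
        using \<epsilon> I_op_in_bmoa[OF f] by (simp add: \<sigma> norm_dist_def I_op_diff[OF f g])
    qed
  qed
  then show "\<exists>l r. l \<in> I_op \<mu> ` bloch_ball B \<and> strict_mono r \<and> limitin mtopology (\<sigma> \<circ> r) l sequentially"
    using g r by blast
qed

text \<open>Both assertions of the theorem are instances: \<open>X\<close> is any normed space of functions whose balls lie
  in Bloch balls. A closed subset of the compact image of a Bloch ball is compact.\<close>

lemma compact_operator_I_op:
  assumes fin: "\<And>f. f \<in> X \<Longrightarrow> N f < \<infinity>"
    and ball: "\<And>f B. f \<in> X \<Longrightarrow> N f \<le> ennreal B \<Longrightarrow> B \<ge> 0 \<Longrightarrow> f \<in> bloch_ball (2 * B)"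
  shows "compact_operator X N bmoa bmoa_norm (I_op \<mu>)"
proof -
  have X: "\<exists>B. f \<in> bloch_ball B" if "f \<in> X" for f
    using ball[OF that, of "enn2real (N f)"] fin[OF that] by auto
  show ?thesis
    unfolding compact_operator_def norm_topology_def
  proof (intro conjI ballI allI impI)
    show "I_op \<mu> \<in> X \<rightarrow> bmoa" using X I_op_in_bmoa by blast
    show "I_op \<mu> (\<lambda>z. f z + g z) = (\<lambda>z. I_op \<mu> f z + I_op \<mu> g z)" if "f \<in> X" "g \<in> X" for f g
      using X[OF that(1)] X[OF that(2)] I_op_add by blast
    show "I_op \<mu> (\<lambda>z. c * f z) = (\<lambda>z. c * I_op \<mu> f z)" for c f
      by (rule I_op_cmult)
    fix S assume S: "S \<subseteq> X \<and> (\<exists>B::real. \<forall>f\<in>S. N f \<le> ennreal B)"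
    then obtain B :: real where B: "\<And>f. f \<in> S \<Longrightarrow> N f \<le> ennreal B" by blast
    define B' where "B' = max 0 B"
    have "N f \<le> ennreal B'" if "f \<in> S" for f
      using B[OF that] by (simp add: B'_def ennreal_max_0)
    then have "I_op \<mu> ` S \<subseteq> I_op \<mu> ` bloch_ball (2 * B')"
      using S ball[of _ B'] by (auto simp: B'_def)
    moreover have compact: "compactin mtopology (I_op \<mu> ` bloch_ball (2 * B'))"
      by (rule compactin_I_op_bloch_ball)
    ultimately have "mtopology closure_of (I_op \<mu> ` S) \<subseteq> I_op \<mu> ` bloch_ball (2 * B')"
      by (intro closure_of_minimal compactin_imp_closedin Hausdorff_space_mtopology)
    then show "compactin mtopology (mtopology closure_of (I_op \<mu> ` S))"
      by (intro closed_compactin[OF compact]) auto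
  qed
qed

end

theorem theorem2p8:
  fixes \<mu> :: "real measure"
  assumes "borel_measure_on_01 \<mu>"
    and "(\<integral>\<^sup>+t. ennreal (ln (2 / (1 - t))) \<partial>\<mu>) < \<infinity>"
    and "vanishing_carleson_measure (density \<mu> (\<lambda>t. ennreal (ln (2 / (1 - t)))))"
  shows "compact_operator bloch bloch_norm bmoa bmoa_norm (I_op \<mu>) \<and>
     compact_operator bmoa bmoa_norm bmoa bmoa_norm (I_op \<mu>)"
proof
  interpret log_vanishing_carleson \<mu>
    by unfold_locales (rule assms)+
  show "compact_operator bloch bloch_norm bmoa bmoa_norm (I_op \<mu>)"
  proof (rule compact_operator_I_op)
    fix f B assume "f \<in> bloch" "bloch_norm f \<le> ennreal B" "B \<ge> 0"
    moreover from this have "bloch_norm f \<le> ennreal (2 * B)"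
      by (elim order_trans) (simp add: ennreal_leI)
    ultimately show "f \<in> bloch_ball (2 * B)"
      by (intro bloch_norm_le_imp_bloch_ball) (auto simp: bloch_def)
  qed (simp add: bloch_def)
  show "compact_operator bmoa bmoa_norm bmoa bmoa_norm (I_op \<mu>)"
    by (rule compact_operator_I_op) (auto simp: bmoa_def bmoa_norm_le_imp_bloch_ball)
qed

end
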